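(* Let $K$ be a finite simplicial complex, $N\in\mathbb N$, $\epsilon>0$, $p\in\mathbb N$, $r\in\mathbb N\cup\{\infty\}$, let $M$ be a smooth manifold, $G:M\to FF_N(K)$ a map, $\mathcal P_p:=\mathrm{PH}_p\circ S\circ G:M\to\mathcal D$, and $\theta\in M$. If there exists an open neighbourhood $U$ of $\theta$ such that $G(\theta')\in\mathrm{cell}(G(\theta))$ for all $\theta'\in U$, and $G|_U$ is of class $C^r$, then the map $\widetilde B:U\to\mathbb R^{2|P^{S(G(\theta))}_p|}$ defined by $$\widetilde B(\theta'):=\widetilde{\mathrm{PH}}_{p,S(G(\theta))}\big(\widetilde S_{G(\theta)}(G(\theta'))\big)\qquad\text{for all }\theta'\in U$$ is a $C^r$ local lift of $\mathcal P_p$ at $\theta$. Thus $\mathcal P_p$ is $r$-differentiable at $\theta$, and (for $r\ge1$) the differential of $\mathcal P_p$ at $\theta$ relative to the local lift $\widetilde B$ is $$\mathrm d_{\theta,\widetilde B}\mathcal P_p=\mathrm d_{\widetilde S_{G(\theta)}(G(\theta))}\widetilde{\mathrm{PH}}_{p,S(G(\theta))}\circ\mathrm d_{G(\theta)}\widetilde S_{G(\theta)}\circ\mathrm d_\theta G|_U .$$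
   Context: Conventions: $\mathbb N=\{0,1,2,\dots\}$. A finite simplicial complex $K$ is a finite collection of non-empty finite sets (simplices) closed under taking non-empty subsets. A field $\mathbb F$ is fixed and $H_p$ is (unreduced) simplicial homology over $\mathbb F$. $\mathrm{sgn}(x)\in\{-1,0,1\}$ is the sign of $x$. Sequences. $\mathrm{Seq}(K)$ is the set of finite sequences $\{K_{T_i}\}_{i=0}^{m}$ of subcomplexes of $K$ indexed by real times $T_0=0<T_1<\dots<T_m$, with first and last complexes empty and consecutive complexes distinct; the trivial sequence consisting of the empty complex alone is included. Let $E=\{+\sigma,-\sigma:\sigma\in K\}$ (insertion and deletion events), partially ordered by $+\tau\le+\sigma$ and $-\sigma\le-\tau$ whenever $\tau\subseteq\sigma$; a total order $<$ on $E$ extending $\le$ is fixed. Write $|+\sigma|=|-\sigma|=\sigma$. A sequence in $\mathrm{Seq}(K)$ is encoded as a triple $f=(n,\mathbf t,\mathbf e)$: record at time $T_i$ ($i\ge1$) the event $+\sigma$ for each $\sigma\in K_{T_i}\setminus K_{T_{i-1}}$ and $-\sigma$ for each $\sigma\in K_{T_{i-1}}\setminus K_{T_i}$; list all $n$ events by increasing time, ties broken by $<$, giving $\mathbf e=(e_1,\dots,e_n)\in E^n$ and times $\mathbf t=(t_1\le\dots\le t_n)$. $\mathrm{SR}(K;<)$ is the set of these triples, identified with $\mathrm{Seq}(K)$. Persistence diagrams. $\mathcal D$ is the set of finite multisets of points of $\mathbb R\times(\mathbb R\cup\{+\infty\})$. Applying the events of $f$ one at a time from $\widetilde K_0=\emptyset$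 ($\widetilde K_i=\widetilde K_{i-1}\cup\{\sigma\}$ if $e_i=+\sigma$, $\widetilde K_{i-1}\setminus\{\sigma\}$ if $e_i=-\sigma$) gives a simplex-wise zigzag filtration with $\widetilde K_0=\widetilde K_n=\emptyset$; its module $H_p(\widetilde K_0)\leftrightarrow\dots\leftrightarrow H_p(\widetilde K_n)$ decomposes uniquely into interval modules $\mathbb I_{[b,d]}$, $P^f_p$ is the set of pairs $(b,d+1)$, and $\mathrm{PH}_p(f):=\{(t_i,t_j)\}_{(i,j)\in P^f_p}\in\mathcal D$. Fixing an order $P^f_p=((a_1,a_2),\dots,(a_{2b-1},a_{2b}))$, $b=|P^f_p|$, put $\widetilde{\mathrm{PH}}_{p,f}:\mathbb R^n\to\mathbb R^{2b}$, $\widetilde{\mathrm{PH}}_{p,f}(\mathbf t)=(t_{a_1},\dots,t_{a_{2b}})$. Filtering functions. $FF_N(K)$ is the set of $v:K\to\{0\}\times\mathbb R^N\times\{0\}$ (coordinates $v(\sigma)_0=0,v(\sigma)_1,\dots,v(\sigma)_N,v(\sigma)_{N+1}=0$) with $v(\sigma)_i\ge v(\tau)_i$ for all $1\le i\le N$ and $\sigma\subsetneq\tau$ in $K$; it is a subset of $(\mathbb R^{N|K|})^*:=\{0\}^{|K|}\times\mathbb R^{N|K|}\times\{0\}^{|K|}$, and $C^r$ for $G|_U$ means as a map into this Euclidean space. For $k\in\{0,\dots,N\}$, $\sigma$ crosses $\epsilon$ at $[k,k+1]$ (for $v$) if $v(\sigma)_k\le\epsilon<v(\sigma)_{k+1}$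 (entry) or $v(\sigma)_k>\epsilon\ge v(\sigma)_{k+1}$ (exit); whenever $v(\sigma)_{k+1}\neq v(\sigma)_k$ put $t^{(k)}_\sigma(v):=k+\frac{\epsilon-v(\sigma)_k}{v(\sigma)_{k+1}-v(\sigma)_k}$. $\mathrm{cell}(v)$, for $v\in FF_N(K)$, is the set of $w\in FF_N(K)$ such that $\mathrm{sgn}(w(\sigma)_i-\epsilon)=\mathrm{sgn}(v(\sigma)_i-\epsilon)$ for all $1\le i\le N$, $\sigma\in K$, and for all $k\in\{0,\dots,N\}$ and all $\sigma,\tau$ crossing $\epsilon$ in $[k,k+1]$: $t^{(k)}_\sigma(w)<t^{(k)}_\tau(w)\iff t^{(k)}_\sigma(v)<t^{(k)}_\tau(v)$ and $t^{(k)}_\sigma(w)=t^{(k)}_\tau(w)\iff t^{(k)}_\sigma(v)=t^{(k)}_\tau(v)$ (by the sign condition the crossings of $v$ and $w$ coincide). The map $S:FF_N(K)\to\mathrm{Seq}(K)\cong\mathrm{SR}(K;<)$. Let $\hat v(\sigma):[0,\infty)\to\mathbb R$ be the piecewise-linear interpolation of $(v(\sigma)_0,\dots,v(\sigma)_{N+1})$ at $0,\dots,N+1$, extended by $0$. For $t\in[0,N+1]$ let $K_t(v):=\{\sigma\in K:\hat v(\sigma)>\epsilon\text{ on }(t,t+\eta)\text{ for some }\eta>0\}$. With $0<T_1<\dots<T_m<N+1$ the jump times of $t\mapsto K_t(v)$ and $T_0=0$, $S(v):=\{K_{T_i}(v)\}_{i=0}^m$. If $S(v)=(n,\mathbf t,\mathbf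 e)$, an indexing function of $v$ is $I:\{1,\dots,n\}\to\{0,\dots,N\}$ with $t_i=t^{(I(i))}_{|e_i|}(v)$ for all $i$ (the crossing at $[I(i),I(i)+1]$ being the one producing the event $e_i$); one exists. Fix one, let $W_v:=\{w\in(\mathbb R^{N|K|})^*:w(|e_i|)_{I(i)+1}\ne w(|e_i|)_{I(i)},\ i=1,\dots,n\}$ and $\widetilde S_v:W_v\to\mathbb R^n$, $\widetilde S_v(w)=(t^{(I(1))}_{|e_1|}(w),\dots,t^{(I(n))}_{|e_n|}(w))$, a $C^\infty$ map on an open set containing $\mathrm{cell}(v)$. Differentiability. $Q_{m,n}:\mathbb R^{2m}\times\mathbb R^n\to\mathcal D$ sends $((b_1,d_1,\dots,b_m,d_m),(v_1,\dots,v_n))$ to the multiset $\{(b_i,d_i)\}_{i}\cup\{(v_j,+\infty)\}_{j}$. A map $B:M\to\mathcal D$ is $r$-differentiable at $\theta$ if there are an open neighbourhood $U$ of $\theta$, $m,n\in\mathbb N$ and a $C^r$ map $\widetilde B:U\to\mathbb R^{2m}\times\mathbb R^n$ (called a local lift of $B$ at $\theta$) with $B|_U=Q_{m,n}\circ\widetilde B$; for $r\ge1$ the differential of $B$ at $\theta$ relative to $\widetilde B$ is $\mathrm d_{\theta,\widetilde B}B:=\mathrm d_\theta\widetilde B$. *)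

theory Defs
  imports "HOL-Analysis.Analysis" "HOL-Library.Extended_Nat" "HOL-Library.Multiset"
begin

section \<open>Euclidean spaces with a prescribed set of coordinates\<close>

text \<open>
  The dimensions below depend on values (number of simplices, of events, of bars) and may be 0.
  So, as in \<^const>\<open>Euclidean_space\<close>, a point of the Euclidean space with finite coordinate set
  \<open>J\<close> is a function vanishing outside \<open>J\<close>.
\<close>

definition euclid :: "'i set \<Rightarrow> ('i \<Rightarrow> real) topology" where
  "euclid J = subtopology (powertop_real UNIV) {x. \<forall>i. i \<notin> J \<longrightarrow> x i = 0}"

abbreviation euclid_points :: "'i set \<Rightarrow> ('i \<Rightarrow> real) set" where
  "euclid_points J \<equiv> topspace (euclid J)"

text \<open>Scalar functions of class C^k on an open set \<open>W\<close> of the Euclidean space on \<open>J\<close>;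
  the function \<open>g' i\<close> is the partial derivative in the direction \<open>i\<close>.\<close>

primrec Ck_scalar :: "'i set \<Rightarrow> nat \<Rightarrow> ('i \<Rightarrow> real) set \<Rightarrow> (('i \<Rightarrow> real) \<Rightarrow> real) \<Rightarrow> bool" where
  "Ck_scalar J 0 W g \<longleftrightarrow> continuous_map (subtopology (euclid J) W) euclideanreal g"
| "Ck_scalar J (Suc k) W g \<longleftrightarrow>
     continuous_map (subtopology (euclid J) W) euclideanreal g \<and>
     (\<exists>g'. \<forall>i\<in>J. (\<forall>x\<in>W. ((\<lambda>t. g (x(i := t))) has_real_derivative g' i x) (at (x i))) \<and>
                 Ck_scalar J k W (g' i))"

definition Cr_on ::
    "enat \<Rightarrow> 'i set \<Rightarrow> 'j set \<Rightarrow> ('i \<Rightarrow> real) set \<Rightarrow> (('i \<Rightarrow> real) \<Rightarrow> ('j \<Rightarrow> real)) \<Rightarrow> bool" where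
  "Cr_on r J J' W f \<longleftrightarrow>
     openin (euclid J) W \<and> f \<in> W \<rightarrow> euclid_points J' \<and>
     (\<forall>j\<in>J'. \<forall>k::nat. enat k \<le> r \<longrightarrow> Ck_scalar J k W (\<lambda>x. f x j))"

definition has_differential ::
    "'i set \<Rightarrow> 'j set \<Rightarrow> ('i \<Rightarrow> real) set \<Rightarrow> (('i \<Rightarrow> real) \<Rightarrow> ('j \<Rightarrow> real)) \<Rightarrow> ('i \<Rightarrow> real) \<Rightarrow>
     (('i \<Rightarrow> real) \<Rightarrow> ('j \<Rightarrow> real)) \<Rightarrow> bool" where
  "has_differential J J' W f x L \<longleftrightarrow>
     L \<in> euclid_points J \<rightarrow> euclid_points J' \<and>
     (\<forall>h\<in>euclid_points J. \<forall>k\<in>euclid_points J. L (\<lambda>i. h i + k i) = (\<lambda>j. L h j + L k j)) \<and>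
     (\<forall>c. \<forall>h\<in>euclid_points J. L (\<lambda>i. c * h i) = (\<lambda>j. c * L h j)) \<and>
     (\<forall>e>0. \<exists>\<delta>>0. \<forall>y\<in>W. L2_set (\<lambda>i. y i - x i) J < \<delta> \<longrightarrow>
        L2_set (\<lambda>j. f y j - f x j - L (\<lambda>i. y i - x i) j) J' \<le> e * L2_set (\<lambda>i. y i - x i) J)"

text \<open>For \<open>x\<close> in an open set \<open>W\<close> of the Euclidean space on \<open>J\<close>, the map chosen here is
  determined on \<open>euclid_points J\<close>.\<close>

definition differential ::
    "'i set \<Rightarrow> 'j set \<Rightarrow> ('i \<Rightarrow> real) set \<Rightarrow> (('i \<Rightarrow> real) \<Rightarrow> ('j \<Rightarrow> real)) \<Rightarrow> ('i \<Rightarrow> real) \<Rightarrow>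
     ('i \<Rightarrow> real) \<Rightarrow> ('j \<Rightarrow> real)" where
  "differential J J' W f x = (SOME L. has_differential J J' W f x L)"


section \<open>Smooth manifolds\<close>

type_synonym 'm chart = "'m set \<times> ('m \<Rightarrow> nat \<Rightarrow> real)"

record 'm manifold =
  mtop :: "'m topology"
  mdim :: nat
  atlas :: "'m chart set"

abbreviation coords :: "'m manifold \<Rightarrow> nat set" where
  "coords M \<equiv> {1..mdim M}"

text \<open>The expression of \<open>f\<close> in a chart; it is meant on the image of the chart domain.\<close>

definition in_chart :: "'m chart \<Rightarrow> ('m \<Rightarrow> 'b) \<Rightarrow> (nat \<Rightarrow> real) \<Rightarrow> 'b" where
  "in_chart c f = f \<circ> inv_into (fst c) (snd c)"

text \<open>The atlas is not required to be maximal: it generates the smooth structure.\<close>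

definition smooth_manifold :: "'m manifold \<Rightarrow> bool" where
  "smooth_manifold M \<longleftrightarrow>
     Hausdorff_space (mtop M) \<and> second_countable (mtop M) \<and>
     (\<Union>c\<in>atlas M. fst c) = topspace (mtop M) \<and>
     (\<forall>(D, \<phi>)\<in>atlas M. openin (mtop M) D \<and> openin (euclid (coords M)) (\<phi> ` D) \<and>
        homeomorphic_map (subtopology (mtop M) D) (subtopology (euclid (coords M)) (\<phi> ` D)) \<phi>) \<and>
     (\<forall>(D, \<phi>)\<in>atlas M. \<forall>(D', \<psi>)\<in>atlas M.
        Cr_on \<infinity> (coords M) (coords M) (\<phi> ` (D \<inter> D')) (in_chart (D, \<phi>) \<psi>))"

definition Cr_map :: "enat \<Rightarrow> 'm manifold \<Rightarrow> 'j set \<Rightarrow> 'm set \<Rightarrow> ('m \<Rightarrow> 'j \<Rightarrow> real) \<Rightarrow> bool" where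
  "Cr_map r M J U f \<longleftrightarrow>
     (\<forall>(D, \<phi>)\<in>atlas M. Cr_on r (coords M) J (\<phi> ` (D \<inter> U)) (in_chart (D, \<phi>) f))"

definition charts_at :: "'m manifold \<Rightarrow> 'm \<Rightarrow> 'm chart set" where
  "charts_at M \<theta> = {c \<in> atlas M. \<theta> \<in> fst c}"

text \<open>A tangent vector is a family of coordinate vectors, one for each chart at \<open>\<theta>\<close>, related by
  the differentials of the coordinate changes.\<close>

definition tangent_space :: "'m manifold \<Rightarrow> 'm \<Rightarrow> ('m chart \<Rightarrow> nat \<Rightarrow> real) set" where
  "tangent_space M \<theta> =
     {\<xi> \<in> charts_at M \<theta> \<rightarrow>\<^sub>E euclid_points (coords M).
        \<forall>c\<in>charts_at M \<theta>. \<forall>c'\<in>charts_at M \<theta>.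
          \<xi> c' = differential (coords M) (coords M) (snd c ` (fst c \<inter> fst c'))
                   (in_chart c (snd c')) (snd c \<theta>) (\<xi> c)}"

text \<open>The differential at \<open>\<theta>\<close> of a map defined on the open set \<open>U\<close>; the chart used is immaterial.\<close>

definition mdifferential ::
    "'m manifold \<Rightarrow> 'j set \<Rightarrow> 'm set \<Rightarrow> ('m \<Rightarrow> 'j \<Rightarrow> real) \<Rightarrow> 'm \<Rightarrow>
     ('m chart \<Rightarrow> nat \<Rightarrow> real) \<Rightarrow> ('j \<Rightarrow> real)" where
  "mdifferential M J U f \<theta> \<xi> =
     (let c = (SOME c. c \<in> charts_at M \<theta>)
      in differential (coords M) J (snd c ` (fst c \<inter> U)) (in_chart c f) (snd c \<theta>) (\<xi> c))"


section \<open>Persistence diagrams and differentiability of maps into them\<close>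

text \<open>The value \<open>- \<infinity>\<close> of \<^typ>\<open>ereal\<close> never occurs as a death time below.\<close>

type_synonym diagram = "(real \<times> ereal) multiset"

text \<open>The product of the spaces of dimensions \<open>2 * m\<close> and \<open>n\<close> is the space on \<open>{1..2 * m + n}\<close>:
  first the coordinates \<open>b\<^sub>1, d\<^sub>1, \<dots>, b\<^sub>m, d\<^sub>m\<close>, then \<open>v\<^sub>1, \<dots>, v\<^sub>n\<close>.\<close>

definition Q :: "nat \<Rightarrow> nat \<Rightarrow> (nat \<Rightarrow> real) \<Rightarrow> diagram" where
  "Q m n x = mset (map (\<lambda>i. (x (2 * i - 1), ereal (x (2 * i)))) [1..<m + 1]) +
             mset (map (\<lambda>j. (x (2 * m + j), \<infinity>)) [1..<n + 1])"

definition local_lift ::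
    "enat \<Rightarrow> 'm manifold \<Rightarrow> ('m \<Rightarrow> diagram) \<Rightarrow> 'm \<Rightarrow> 'm set \<Rightarrow> nat \<Rightarrow> nat \<Rightarrow> ('m \<Rightarrow> nat \<Rightarrow> real) \<Rightarrow> bool" where
  "local_lift r M B \<theta> U m n Bt \<longleftrightarrow>
     openin (mtop M) U \<and> \<theta> \<in> U \<and> Cr_map r M {1..2 * m + n} U Bt \<and> (\<forall>x\<in>U. B x = Q m n (Bt x))"

definition r_differentiable :: "enat \<Rightarrow> 'm manifold \<Rightarrow> ('m \<Rightarrow> diagram) \<Rightarrow> 'm \<Rightarrow> bool" where
  "r_differentiable r M B \<theta> \<longleftrightarrow> (\<exists>U m n Bt. local_lift r M B \<theta> U m n Bt)"

definition lift_differential ::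
    "'m manifold \<Rightarrow> 'm set \<Rightarrow> nat \<Rightarrow> nat \<Rightarrow> ('m \<Rightarrow> nat \<Rightarrow> real) \<Rightarrow> 'm \<Rightarrow>
     ('m chart \<Rightarrow> nat \<Rightarrow> real) \<Rightarrow> (nat \<Rightarrow> real)" where
  "lift_differential M U m n Bt \<theta> = mdifferential M {1..2 * m + n} U Bt \<theta>"


section \<open>Zigzag modules and their barcodes\<close>

record ('f, 'a) vspace =
  vcarrier :: "'a set"
  vplus :: "'a \<Rightarrow> 'a \<Rightarrow> 'a"
  vscale :: "'f \<Rightarrow> 'a \<Rightarrow> 'a"

text \<open>\<open>arrow V i\<close> goes from \<open>space V i\<close> to \<open>space V (i + 1)\<close> if \<open>forward V i\<close>, and from
  \<open>space V (i + 1)\<close> to \<open>space V i\<close> otherwise. The spaces have indices \<open>0, \<dots>, len V\<close>.\<close>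

record ('f, 'a) zigzag =
  len :: nat
  forward :: "nat \<Rightarrow> bool"
  space :: "nat \<Rightarrow> ('f, 'a) vspace"
  arrow :: "nat \<Rightarrow> 'a \<Rightarrow> 'a"

definition vspace_iso :: "('f, 'a) vspace \<Rightarrow> ('f, 'b) vspace \<Rightarrow> ('a \<Rightarrow> 'b) \<Rightarrow> bool" where
  "vspace_iso V W \<phi> \<longleftrightarrow>
     bij_betw \<phi> (vcarrier V) (vcarrier W) \<and>
     (\<forall>x\<in>vcarrier V. \<forall>y\<in>vcarrier V. \<phi> (vplus V x y) = vplus W (\<phi> x) (\<phi> y)) \<and>
     (\<forall>c. \<forall>x\<in>vcarrier V. \<phi> (vscale V c x) = vscale W c (\<phi> x))"

definition zigzag_iso :: "('f, 'a) zigzag \<Rightarrow> ('f, 'b) zigzag \<Rightarrow> bool" where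
  "zigzag_iso V W \<longleftrightarrow>
     len V = len W \<and> (\<forall>i<len V. forward V i = forward W i) \<and>
     (\<exists>\<phi>. (\<forall>i\<le>len V. vspace_iso (zigzag.space V i) (zigzag.space W i) (\<phi> i)) \<and>
          (\<forall>i<len V.
             if forward V i
             then \<forall>x\<in>vcarrier (zigzag.space V i). \<phi> (i + 1) (arrow V i x) = arrow W i (\<phi> i x)
             else \<forall>x\<in>vcarrier (zigzag.space V (i + 1)). \<phi> i (arrow V i x) = arrow W i (\<phi> (i + 1) x)))"

definition interval_module :: "nat \<Rightarrow> (nat \<Rightarrow> bool) \<Rightarrow> nat \<times> nat \<Rightarrow> ('f::field, 'f) zigzag" where
  "interval_module l fw = (\<lambda>(b, d).
     \<lparr>len = l, forward = fw,
      space = (\<lambda>i. \<lparr>vcarrier = (if b \<le> i \<and> i \<le> d then UNIV else {0}), vplus = (+), vscale = (*)\<rparr>),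
      arrow = (\<lambda>i x. if b \<le> i \<and> i + 1 \<le> d then x else 0)\<rparr>)"

definition direct_sum ::
    "nat \<Rightarrow> (nat \<Rightarrow> bool) \<Rightarrow> ('f, 'a) zigzag list \<Rightarrow> ('f, nat \<Rightarrow> 'a) zigzag" where
  "direct_sum l fw Vs =
     \<lparr>len = l, forward = fw,
      space = (\<lambda>i. \<lparr>vcarrier = (\<Pi>\<^sub>E s\<in>{..<length Vs}. vcarrier (zigzag.space (Vs ! s) i)),
                     vplus = (\<lambda>x y. \<lambda>s\<in>{..<length Vs}. vplus (zigzag.space (Vs ! s) i) (x s) (y s)),
                     vscale = (\<lambda>c x. \<lambda>s\<in>{..<length Vs}. vscale (zigzag.space (Vs ! s) i) c (x s))\<rparr>),
      arrow = (\<lambda>i x. \<lambda>s\<in>{..<length Vs}. arrow (Vs ! s) i (x s))\<rparr>"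

text \<open>Well defined for pointwise finite-dimensional modules, by existence and uniqueness of
  interval decompositions.\<close>

definition barcode :: "('f::field, 'a) zigzag \<Rightarrow> (nat \<times> nat) multiset" where
  "barcode V = (THE B. \<exists>bs. mset bs = B \<and> (\<forall>(b, d)\<in>set bs. b \<le> d \<and> d \<le> len V) \<and>
     zigzag_iso V (direct_sum (len V) (forward V) (map (interval_module (len V) (forward V)) bs)))"


section \<open>Simplicial homology\<close>

definition finite_simplicial_complex :: "'v set set \<Rightarrow> bool" where
  "finite_simplicial_complex K \<longleftrightarrow>
     finite K \<and> (\<forall>\<sigma>\<in>K. finite \<sigma> \<and> \<sigma> \<noteq> {}) \<and> (\<forall>\<sigma>\<in>K. \<forall>\<tau>. \<tau> \<noteq> {} \<and> \<tau> \<subseteq> \<sigma> \<longrightarrow> \<tau> \<in> K)"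

text \<open>An oriented chain is an alternating function of the ordered simplices \<open>[v\<^sub>0, \<dots>, v\<^sub>p]\<close>: its
  value is the coefficient of the corresponding oriented simplex.\<close>

definition chains :: "nat \<Rightarrow> 'v set set \<Rightarrow> ('v list \<Rightarrow> 'f::field) set" where
  "chains p L =
     {c. (\<forall>vs. c vs \<noteq> 0 \<longrightarrow> length vs = p + 1 \<and> distinct vs \<and> set vs \<in> L) \<and>
         (\<forall>vs i j. i < j \<and> j < length vs \<longrightarrow> c (vs[i := vs ! j, j := vs ! i]) = - c vs)}"

text \<open>Since \<open>\<partial>[v\<^sub>0, \<dots>, v\<^sub>p]\<close> is the alternating sum of the faces, and moving \<open>v\<^sub>i\<close> to the front
  costs the sign \<open>(-1)^i\<close>, the coefficient of \<open>\<partial>c\<close> at \<open>w\<close> is the sum of those of \<open>c\<close> at \<open>v # w\<close>.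
  Homology is not reduced, so the boundary of a 0-chain is 0.\<close>

definition boundary :: "('v list \<Rightarrow> 'f::field) \<Rightarrow> 'v list \<Rightarrow> 'f" where
  "boundary c w = (if w = [] then 0 else (\<Sum>v | c (v # w) \<noteq> 0. c (v # w)))"

definition cycles :: "nat \<Rightarrow> 'v set set \<Rightarrow> ('v list \<Rightarrow> 'f::field) set" where
  "cycles p L = {c \<in> chains p L. boundary c = (\<lambda>_. 0)}"

definition homology_class ::
    "nat \<Rightarrow> 'v set set \<Rightarrow> ('v list \<Rightarrow> 'f::field) \<Rightarrow> ('v list \<Rightarrow> 'f) set" where
  "homology_class p L z = (\<lambda>c w. z w + boundary c w) ` chains (p + 1) L"

definition homology :: "nat \<Rightarrow> 'v set set \<Rightarrow> ('f::field, ('v list \<Rightarrow> 'f) set) vspace" where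
  "homology p L =
     \<lparr>vcarrier = homology_class p L ` cycles p L,
      vplus = (\<lambda>X Y. \<Union>x\<in>X. \<Union>y\<in>Y. homology_class p L (\<lambda>w. x w + y w)),
      vscale = (\<lambda>a X. \<Union>x\<in>X. homology_class p L (\<lambda>w. a * x w))\<rparr>"

text \<open>The map induced in homology by the inclusion of a subcomplex in \<open>L\<close>.\<close>

definition homology_incl ::
    "nat \<Rightarrow> 'v set set \<Rightarrow> ('v list \<Rightarrow> 'f::field) set \<Rightarrow> ('v list \<Rightarrow> 'f) set" where
  "homology_incl p L X = (\<Union>x\<in>X. homology_class p L x)"


section \<open>Events, sequences of complexes and their persistence diagrams\<close>

datatype 'v event = Ins "'v set" | Del "'v set"

fun esimplex :: "'v event \<Rightarrow> 'v set" where
  "esimplex (Ins \<sigma>) = \<sigma>"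
| "esimplex (Del \<sigma>) = \<sigma>"

fun is_insertion :: "'v event \<Rightarrow> bool" where
  "is_insertion (Ins \<sigma>) \<longleftrightarrow> True"
| "is_insertion (Del \<sigma>) \<longleftrightarrow> False"

fun event_le :: "'v event \<Rightarrow> 'v event \<Rightarrow> bool" where
  "event_le (Ins \<tau>) (Ins \<sigma>) \<longleftrightarrow> \<tau> \<subseteq> \<sigma>"
| "event_le (Del \<sigma>) (Del \<tau>) \<longleftrightarrow> \<tau> \<subseteq> \<sigma>"
| "event_le _ _ \<longleftrightarrow> False"

definition event_order :: "'v set set \<Rightarrow> 'v event rel \<Rightarrow> bool" where
  "event_order K R \<longleftrightarrow>
     linear_order_on (Ins ` K \<union> Del ` K) R \<and>
     (\<forall>a\<in>Ins ` K \<union> Del ` K. \<forall>b\<in>Ins ` K \<union> Del ` K. event_le a b \<longrightarrow> (a, b) \<in> R)"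

text \<open>A sequence of complexes is a list of pairs \<open>(T\<^sub>i, K\<^sub>T\<^sub>i)\<close>. A triple \<open>(n, t, e)\<close> is the list
  of pairs \<open>(t\<^sub>i, e\<^sub>i)\<close>; its components are given by \<^const>\<open>length\<close>, \<open>ev_time\<close> and \<open>ev\<close>,
  with indices starting at 1.\<close>

type_synonym 'v complex_seq = "(real \<times> 'v set set) list"
type_synonym 'v event_seq = "(real \<times> 'v event) list"

definition timed_events :: "'v complex_seq \<Rightarrow> (real \<times> 'v event) set" where
  "timed_events xs =
     {(fst (xs ! i), a) | i a. 1 \<le> i \<and> i < length xs \<and>
        a \<in> Ins ` (snd (xs ! i) - snd (xs ! (i - 1))) \<union> Del ` (snd (xs ! (i - 1)) - snd (xs ! i))}"

definition encode :: "'v event rel \<Rightarrow> 'v complex_seq \<Rightarrow> 'v event_seq" where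
  "encode R xs = (THE ys. distinct ys \<and> set ys = timed_events xs \<and>
     sorted_wrt (\<lambda>(s, a) (t, b). s < t \<or> s = t \<and> (a, b) \<in> R) ys)"

definition ev_time :: "'v event_seq \<Rightarrow> nat \<Rightarrow> real" where
  "ev_time f i = (if i \<in> {1..length f} then fst (f ! (i - 1)) else 0)"

definition ev :: "'v event_seq \<Rightarrow> nat \<Rightarrow> 'v event" where
  "ev f i = snd (f ! (i - 1))"

fun apply_event :: "'v event \<Rightarrow> 'v set set \<Rightarrow> 'v set set" where
  "apply_event (Ins \<sigma>) L = insert \<sigma> L"
| "apply_event (Del \<sigma>) L = L - {\<sigma>}"

definition complex_after :: "'v event_seq \<Rightarrow> nat \<Rightarrow> 'v set set" where
  "complex_after f i = fold apply_event (take i (map snd f)) {}"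

definition homology_zigzag ::
    "nat \<Rightarrow> 'v event_seq \<Rightarrow> ('f::field, ('v list \<Rightarrow> 'f) set) zigzag" where
  "homology_zigzag p f =
     \<lparr>len = length f,
      forward = (\<lambda>i. is_insertion (ev f (i + 1))),
      space = (\<lambda>i. homology p (complex_after f i)),
      arrow = (\<lambda>i. homology_incl p
        (if is_insertion (ev f (i + 1)) then complex_after f (i + 1) else complex_after f i))\<rparr>"

text \<open>The coefficient field is passed as a type.\<close>

definition persistence_pairs ::
    "'f::field itself \<Rightarrow> nat \<Rightarrow> 'v event_seq \<Rightarrow> (nat \<times> nat) multiset" where
  "persistence_pairs F p f =
     image_mset (\<lambda>(b, d). (b, d + 1))
       (barcode (homology_zigzag p f :: ('f, ('v list \<Rightarrow> 'f) set) zigzag))"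

definition PH :: "'f::field itself \<Rightarrow> nat \<Rightarrow> 'v event_seq \<Rightarrow> diagram" where
  "PH F p f = image_mset (\<lambda>(i, j). (ev_time f i, ereal (ev_time f j))) (persistence_pairs F p f)"

text \<open>\<open>ps\<close> is the chosen enumeration of the persistence pairs.\<close>

definition PH_lift :: "(nat \<times> nat) list \<Rightarrow> (nat \<Rightarrow> real) \<Rightarrow> (nat \<Rightarrow> real)" where
  "PH_lift ps t =
     (let as = concat (map (\<lambda>(i, j). [i, j]) ps)
      in (\<lambda>k. if k \<in> {1..length as} then t (as ! (k - 1)) else 0))"


section \<open>Filtering functions\<close>

text \<open>Vanishing outside \<open>K \<times> {1..N}\<close> includes \<open>v (\<sigma>, 0) = 0 = v (\<sigma>, N + 1)\<close>.\<close>

definition FF :: "nat \<Rightarrow> 'v set set \<Rightarrow> ('v set \<times> nat \<Rightarrow> real) set" where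
  "FF N K = {v \<in> euclid_points (K \<times> {1..N}).
     \<forall>i\<in>{1..N}. \<forall>\<sigma>\<in>K. \<forall>\<tau>\<in>K. \<sigma> \<subset> \<tau> \<longrightarrow> v (\<sigma>, i) \<ge> v (\<tau>, i)}"

definition entry :: "real \<Rightarrow> ('v set \<times> nat \<Rightarrow> real) \<Rightarrow> 'v set \<Rightarrow> nat \<Rightarrow> bool" where
  "entry \<epsilon> v \<sigma> k \<longleftrightarrow> v (\<sigma>, k) \<le> \<epsilon> \<and> \<epsilon> < v (\<sigma>, k + 1)"

definition exit :: "real \<Rightarrow> ('v set \<times> nat \<Rightarrow> real) \<Rightarrow> 'v set \<Rightarrow> nat \<Rightarrow> bool" where
  "exit \<epsilon> v \<sigma> k \<longleftrightarrow> v (\<sigma>, k) > \<epsilon> \<and> \<epsilon> \<ge> v (\<sigma>, k + 1)"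

definition crosses :: "real \<Rightarrow> ('v set \<times> nat \<Rightarrow> real) \<Rightarrow> 'v set \<Rightarrow> nat \<Rightarrow> bool" where
  "crosses \<epsilon> v \<sigma> k \<longleftrightarrow> entry \<epsilon> v \<sigma> k \<or> exit \<epsilon> v \<sigma> k"

definition cross_time :: "real \<Rightarrow> nat \<Rightarrow> 'v set \<Rightarrow> ('v set \<times> nat \<Rightarrow> real) \<Rightarrow> real" where
  "cross_time \<epsilon> k \<sigma> v = real k + (\<epsilon> - v (\<sigma>, k)) / (v (\<sigma>, k + 1) - v (\<sigma>, k))"

definition cell ::
    "nat \<Rightarrow> 'v set set \<Rightarrow> real \<Rightarrow> ('v set \<times> nat \<Rightarrow> real) \<Rightarrow> ('v set \<times> nat \<Rightarrow> real) set" where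
  "cell N K \<epsilon> v = {w \<in> FF N K.
     (\<forall>i\<in>{1..N}. \<forall>\<sigma>\<in>K. sgn (w (\<sigma>, i) - \<epsilon>) = sgn (v (\<sigma>, i) - \<epsilon>)) \<and>
     (\<forall>k\<in>{0..N}. \<forall>\<sigma>\<in>K. \<forall>\<tau>\<in>K. crosses \<epsilon> v \<sigma> k \<and> crosses \<epsilon> v \<tau> k \<longrightarrow>
        (cross_time \<epsilon> k \<sigma> w < cross_time \<epsilon> k \<tau> w \<longleftrightarrow> cross_time \<epsilon> k \<sigma> v < cross_time \<epsilon> k \<tau> v) \<and>
        (cross_time \<epsilon> k \<sigma> w = cross_time \<epsilon> k \<tau> w \<longleftrightarrow> cross_time \<epsilon> k \<sigma> v = cross_time \<epsilon> k \<tau> v))}"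

definition interpolation :: "nat \<Rightarrow> ('v set \<times> nat \<Rightarrow> real) \<Rightarrow> 'v set \<Rightarrow> real \<Rightarrow> real" where
  "interpolation N v \<sigma> t =
     (if 0 \<le> t \<and> t < real N + 1
      then let k = nat \<lfloor>t\<rfloor> in v (\<sigma>, k) + (t - real k) * (v (\<sigma>, k + 1) - v (\<sigma>, k))
      else 0)"

definition complex_at ::
    "nat \<Rightarrow> 'v set set \<Rightarrow> real \<Rightarrow> ('v set \<times> nat \<Rightarrow> real) \<Rightarrow> real \<Rightarrow> 'v set set" where
  "complex_at N K \<epsilon> v t = {\<sigma> \<in> K. \<exists>\<eta>>0. \<forall>s\<in>{t<..<t + \<eta>}. interpolation N v \<sigma> s > \<epsilon>}"

definition jump_times :: "nat \<Rightarrow> 'v set set \<Rightarrow> real \<Rightarrow> ('v set \<times> nat \<Rightarrow> real) \<Rightarrow> real set" where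
  "jump_times N K \<epsilon> v = {t \<in> {0<..<real N + 1}.
     \<not> (\<forall>\<^sub>F s in at t. complex_at N K \<epsilon> v s = complex_at N K \<epsilon> v t)}"

definition complex_seq ::
    "nat \<Rightarrow> 'v set set \<Rightarrow> real \<Rightarrow> ('v set \<times> nat \<Rightarrow> real) \<Rightarrow> 'v complex_seq" where
  "complex_seq N K \<epsilon> v =
     map (\<lambda>T. (T, complex_at N K \<epsilon> v T)) (0 # sorted_list_of_set (jump_times N K \<epsilon> v))"

definition S ::
    "nat \<Rightarrow> 'v set set \<Rightarrow> real \<Rightarrow> 'v event rel \<Rightarrow> ('v set \<times> nat \<Rightarrow> real) \<Rightarrow> 'v event_seq" where
  "S N K \<epsilon> R v = encode R (complex_seq N K \<epsilon> v)"

text \<open>An insertion is produced by an entry and a deletion by an exit. This matters when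
  \<open>\<epsilon>\<close> is attained at an integer time, since both neighbouring intervals then have that time.\<close>

definition indexing_function ::
    "nat \<Rightarrow> real \<Rightarrow> ('v set \<times> nat \<Rightarrow> real) \<Rightarrow> 'v event_seq \<Rightarrow> (nat \<Rightarrow> nat) \<Rightarrow> bool" where
  "indexing_function N \<epsilon> v f I \<longleftrightarrow>
     (\<forall>i\<in>{1..length f}. I i \<in> {0..N} \<and>
        (if is_insertion (ev f i) then entry \<epsilon> v (esimplex (ev f i)) (I i)
         else exit \<epsilon> v (esimplex (ev f i)) (I i)) \<and>
        ev_time f i = cross_time \<epsilon> (I i) (esimplex (ev f i)) v)"

definition S_domain ::
    "nat \<Rightarrow> 'v set set \<Rightarrow> 'v event_seq \<Rightarrow> (nat \<Rightarrow> nat) \<Rightarrow> ('v set \<times> nat \<Rightarrow> real) set" where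
  "S_domain N K f I = {w \<in> euclid_points (K \<times> {1..N}).
     \<forall>i\<in>{1..length f}. w (esimplex (ev f i), I i + 1) \<noteq> w (esimplex (ev f i), I i)}"

definition S_lift ::
    "real \<Rightarrow> 'v event_seq \<Rightarrow> (nat \<Rightarrow> nat) \<Rightarrow> ('v set \<times> nat \<Rightarrow> real) \<Rightarrow> (nat \<Rightarrow> real)" where
  "S_lift \<epsilon> f I w =
     (\<lambda>i. if i \<in> {1..length f} then cross_time \<epsilon> (I i) (esimplex (ev f i)) w else 0)"

end

theory Submission
  imports Defs
begin

text \<open>
  A simplex that enters (or leaves) the superlevel complex does so at the crossing time of one linear
  piece of its interpolation, unless it leaves and re-enters at the same integer time. Which crossings
  produce events depends only on the signs of \<open>v (\<sigma>, i) - \<epsilon>\<close>, and their order only on these signs and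
  on the order of the crossing times within each unit interval. So the list of events is constant on a
  cell, hence so is the zigzag module, while the event times are the rational functions \<^const>\<open>S_lift\<close>
  of the filtering function. This makes the diagram a fixed coordinate selection \<^const>\<open>PH_lift\<close> of
  these times, and the formula for the differential is the chain rule.
\<close>

section \<open>Events of a filtering function\<close>

text \<open>The delicate case is an integer time at which a simplex has value exactly
  \<open>\<epsilon>\<close>. Both adjacent linear pieces may then cross at that time, and one piece
  alone does not tell whether the complex changes. The complex is right-continuous by definition, so
  jumps are found by comparing it with its left limit. Entry times are attached to the half-open
  interval [k, k + 1) and exit times to (k, k + 1], which makes the index of an event unique.

  A cell need not be open, while differentials are taken on open sets. The event times are therefore
  differentiated on the larger open set \<open>S_domain\<close>, where no denominator vanishes. As
  \<open>Ck_scalar\<close> is defined by iterated partial derivatives, two tools are built: closure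
  under field operations for the C^r claim, and total differentiability of C^1 maps with uniqueness
  of the differential for the formula, since \<open>differential\<close> is a choice.\<close>

lemma FF_boundary:
  assumes "v \<in> FF N K"
  shows "v (\<sigma>, 0) = 0" "v (\<sigma>, Suc N) = 0" "\<sigma> \<notin> K \<Longrightarrow> v (\<sigma>, k) = 0"
  using assms by (auto simp: FF_def euclid_def)

section \<open>Crossing times and one-sided limits of the complex\<close>

lemma cross_time_entry:
  assumes "entry \<epsilon> v \<sigma> k"
  shows "real k \<le> cross_time \<epsilon> k \<sigma> v" "cross_time \<epsilon> k \<sigma> v < real k + 1"
    "cross_time \<epsilon> k \<sigma> v = real k \<longleftrightarrow> v (\<sigma>, k) = \<epsilon>"
  using assms by (auto simp: entry_def cross_time_def field_simps)

lemma cross_time_exit: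
  assumes "exit \<epsilon> v \<sigma> k"
  shows "real k < cross_time \<epsilon> k \<sigma> v" "cross_time \<epsilon> k \<sigma> v \<le> real k + 1"
    "cross_time \<epsilon> k \<sigma> v = real k + 1 \<longleftrightarrow> v (\<sigma>, k + 1) = \<epsilon>"
  using assms by (auto simp: exit_def cross_time_def field_simps)

text \<open>On one linear piece the height above \<open>\<epsilon>\<close> is a convex combination
  of the heights at the two grid points. Equal signs settle it; in the mixed cases it vanishes
  exactly at the crossing time.\<close>

lemma interpolation_gt_iff:
  assumes "k \<le> N" "real k \<le> t" "t < real k + 1"
  shows "interpolation N v \<sigma> t > \<epsilon> \<longleftrightarrow>
    entry \<epsilon> v \<sigma> k \<and> cross_time \<epsilon> k \<sigma> v < t \<or> exit \<epsilon> v \<sigma> k \<and> t < cross_time \<epsilon> k \<sigma> v \<or>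
    \<epsilon> < v (\<sigma>, k) \<and> \<epsilon> < v (\<sigma>, k + 1)"
proof -
  have "\<lfloor>t\<rfloor> = int k" using assms by linarith
  then have val: "interpolation N v \<sigma> t = v (\<sigma>, k) + (t - real k) * (v (\<sigma>, k + 1) - v (\<sigma>, k))"
    using assms by (auto simp: interpolation_def Let_def)
  define s where "s = t - real k"
  have "0 \<le> s" "s < 1" using assms by (auto simp: s_def)
  define a b where "a = v (\<sigma>, k) - \<epsilon>" and "b = v (\<sigma>, k + 1) - \<epsilon>"
  have eq: "interpolation N v \<sigma> t - \<epsilon> = (1 - s) * a + s * b"
    by (simp add: val s_def a_def b_def algebra_simps)
  consider "a > 0 \<and> b > 0" | "a \<le> 0 \<and> b > 0" | "a > 0 \<and> b \<le> 0" | "a \<le> 0 \<and> b \<le> 0" by linarith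
  then show ?thesis
  proof cases
    case 1
    then have "(1 - s) * a + s * b > 0"
      using \<open>0 \<le> s\<close> \<open>s < 1\<close> by (intro add_pos_nonneg) auto
    then show ?thesis using 1 eq by (auto simp: a_def b_def)
  next
    case 2
    then have "cross_time \<epsilon> k \<sigma> v < t \<longleftrightarrow> (1 - s) * a + s * b > 0"
      by (simp add: cross_time_def a_def b_def s_def field_simps)
    then show ?thesis using 2 eq by (auto simp: a_def b_def entry_def exit_def)
  next
    case 3
    then have "t < cross_time \<epsilon> k \<sigma> v \<longleftrightarrow> (1 - s) * a + s * b > 0"
      by (simp add: cross_time_def a_def b_def s_def field_simps)
    then show ?thesis using 3 eq by (auto simp: a_def b_def entry_def exit_def)
  next
    case 4
    then have "(1 - s) * a + s * b \<le> 0"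
      using \<open>0 \<le> s\<close> \<open>s < 1\<close> by (intro add_nonpos_nonpos mult_nonneg_nonpos) auto
    then show ?thesis using 4 eq by (auto simp: a_def b_def entry_def exit_def)
  qed
qed

text \<open>Membership looks at times just after t. This turns the strict inequality at an entry
  into a weak one and keeps it strict at an exit, which is right-continuity.\<close>

lemma complex_at_iff:
  assumes "k \<le> N" "real k \<le> t" "t < real k + 1" "\<sigma> \<in> K"
  shows "\<sigma> \<in> complex_at N K \<epsilon> v t \<longleftrightarrow>
    entry \<epsilon> v \<sigma> k \<and> cross_time \<epsilon> k \<sigma> v \<le> t \<or> exit \<epsilon> v \<sigma> k \<and> t < cross_time \<epsilon> k \<sigma> v \<or>
    \<epsilon> < v (\<sigma>, k) \<and> \<epsilon> < v (\<sigma>, k + 1)" (is "_ \<longleftrightarrow> ?R")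
proof
  assume "\<sigma> \<in> complex_at N K \<epsilon> v t"
  then obtain \<eta> where "\<eta> > 0" and pos: "\<And>s. t < s \<Longrightarrow> s < t + \<eta> \<Longrightarrow> interpolation N v \<sigma> s > \<epsilon>"
    by (auto simp: complex_at_def)
  have *: "entry \<epsilon> v \<sigma> k \<and> cross_time \<epsilon> k \<sigma> v < s \<or> exit \<epsilon> v \<sigma> k \<and> s < cross_time \<epsilon> k \<sigma> v \<or>
    \<epsilon> < v (\<sigma>, k) \<and> \<epsilon> < v (\<sigma>, k + 1)" if "t < s" "s < min (t + \<eta>) (real k + 1)" for s
    using interpolation_gt_iff[of k N s] pos[of s] assms that by auto
  have "t < min (t + \<eta>) (real k + 1)" using assms \<open>\<eta> > 0\<close> by auto
  then obtain s where s: "t < s" "s < min (t + \<eta>) (real k + 1)" using dense by blast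
  \<comment> \<open>An entry after t would leave the times just after t at or below
    \<open>\<epsilon>\<close>, a contradiction; in the remaining cases the single sample s
    decides.\<close>
  show ?R
  proof (cases "entry \<epsilon> v \<sigma> k \<and> t < cross_time \<epsilon> k \<sigma> v")
    case True
    then have "t < min (t + \<eta>) (cross_time \<epsilon> k \<sigma> v)" using \<open>\<eta> > 0\<close> by auto
    then obtain s' where s': "t < s'" "s' < min (t + \<eta>) (cross_time \<epsilon> k \<sigma> v)" using dense by blast
    with cross_time_entry[of \<epsilon> v \<sigma> k] True *[of s'] show ?thesis by (auto simp: entry_def exit_def)
  qed (use *[OF s] s in auto)
next
  assume R: ?R
  \<comment> \<open>Between t and b the simplex stays above \<open>\<epsilon>\<close>: b is its exit
    time, or the end of the piece.\<close>
  define b where "b = (if exit \<epsilon> v \<sigma> k then cross_time \<epsilon> k \<sigma> v else real k + 1)"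
  have b: "t < b" "b \<le> real k + 1"
    using R cross_time_exit[of \<epsilon> v \<sigma> k] assms by (auto simp: b_def entry_def exit_def)
  have "interpolation N v \<sigma> s > \<epsilon>" if "t < s" "s < b" for s
    using interpolation_gt_iff[of k N s] that assms R b by (auto simp: b_def split: if_splits)
  then show "\<sigma> \<in> complex_at N K \<epsilon> v t"
    using assms b by (auto simp: complex_at_def intro!: exI[of _ "b - t"])
qed

text \<open>The left limit of the complex. With right-continuity it reduces a jump at t to a
  comparison of two complexes at t, with no reference to the preceding jump time.\<close>

definition left_complex ::
    "nat \<Rightarrow> 'v set set \<Rightarrow> real \<Rightarrow> ('v set \<times> nat \<Rightarrow> real) \<Rightarrow> real \<Rightarrow> 'v set set" where
  "left_complex N K \<epsilon> v t = {\<sigma> \<in> K. \<forall>\<^sub>F s in at_left t. \<sigma> \<in> complex_at N K \<epsilon> v s}"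

lemma eventually_left_complex_at:
  assumes "k \<le> N" "real k < t" "t \<le> real k + 1" "\<sigma> \<in> K"
  shows "\<forall>\<^sub>F s in at_left t. \<sigma> \<in> complex_at N K \<epsilon> v s \<longleftrightarrow>
    entry \<epsilon> v \<sigma> k \<and> cross_time \<epsilon> k \<sigma> v < t \<or> exit \<epsilon> v \<sigma> k \<and> t \<le> cross_time \<epsilon> k \<sigma> v \<or>
    \<epsilon> < v (\<sigma>, k) \<and> \<epsilon> < v (\<sigma>, k + 1)"
proof -
  \<comment> \<open>Between b and t this piece has no further crossing of \<sigma>, so the
    membership formula is constant there.\<close>
  define b where "b = (if cross_time \<epsilon> k \<sigma> v < t then max (real k) (cross_time \<epsilon> k \<sigma> v) else real k)"
  have "b < t" using assms by (auto simp: b_def)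
  moreover have "\<sigma> \<in> complex_at N K \<epsilon> v s \<longleftrightarrow>
    entry \<epsilon> v \<sigma> k \<and> cross_time \<epsilon> k \<sigma> v < t \<or> exit \<epsilon> v \<sigma> k \<and> t \<le> cross_time \<epsilon> k \<sigma> v \<or>
    \<epsilon> < v (\<sigma>, k) \<and> \<epsilon> < v (\<sigma>, k + 1)" if "b < s" "s < t" for s
    using complex_at_iff[of k N s \<sigma> K \<epsilon> v] assms that by (auto simp: b_def split: if_splits)
  ultimately show ?thesis
    unfolding eventually_at_left_field by blast
qed

lemma left_complex_iff:
  assumes "k \<le> N" "real k < t" "t \<le> real k + 1" "\<sigma> \<in> K"
  shows "\<sigma> \<in> left_complex N K \<epsilon> v t \<longleftrightarrow>
    entry \<epsilon> v \<sigma> k \<and> cross_time \<epsilon> k \<sigma> v < t \<or> exit \<epsilon> v \<sigma> k \<and> t \<le> cross_time \<epsilon> k \<sigma> v \<or>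
    \<epsilon> < v (\<sigma>, k) \<and> \<epsilon> < v (\<sigma>, k + 1)" (is "_ \<longleftrightarrow> ?R")
proof -
  have "(\<forall>\<^sub>F s in at_left t. \<sigma> \<in> complex_at N K \<epsilon> v s) \<longleftrightarrow> (\<forall>\<^sub>F s in at_left t. ?R)"
    by (rule eventually_cong[OF eventually_left_complex_at[OF assms]]) auto
  also have "\<dots> \<longleftrightarrow> ?R" by (cases ?R) (simp_all add: trivial_limit_at_left_real)
  finally show ?thesis using assms by (simp add: left_complex_def)
qed

text \<open>Integer times need both adjacent pieces: \<open>complex_at\<close> is read off from the
  piece on the right, \<open>left_complex\<close> from the one on the left, and the two can differ
  only at height exactly \<open>\<epsilon>\<close>.\<close>

lemma complex_at_integer:
  assumes "k \<le> N" "\<sigma> \<in> K"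
  shows "\<sigma> \<in> complex_at N K \<epsilon> v (real k) \<longleftrightarrow> \<epsilon> < v (\<sigma>, k) \<or> v (\<sigma>, k) = \<epsilon> \<and> \<epsilon> < v (\<sigma>, k + 1)"
  using complex_at_iff[of k N "real k" \<sigma> K \<epsilon> v] assms cross_time_entry[of \<epsilon> v \<sigma> k]
    cross_time_exit[of \<epsilon> v \<sigma> k]
  by (cases "\<epsilon> < v (\<sigma>, k)"; cases "\<epsilon> < v (\<sigma>, k + 1)") (auto simp: entry_def exit_def)

lemma left_complex_integer:
  assumes "k \<le> N" "\<sigma> \<in> K"
  shows "\<sigma> \<in> left_complex N K \<epsilon> v (real k + 1) \<longleftrightarrow>
    \<epsilon> < v (\<sigma>, k + 1) \<or> v (\<sigma>, k + 1) = \<epsilon> \<and> \<epsilon> < v (\<sigma>, k)"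
  using left_complex_iff[of k N "real k + 1" \<sigma> K \<epsilon> v] assms cross_time_entry[of \<epsilon> v \<sigma> k]
    cross_time_exit[of \<epsilon> v \<sigma> k]
  by (cases "\<epsilon> < v (\<sigma>, k)"; cases "\<epsilon> < v (\<sigma>, k + 1)") (auto simp: entry_def exit_def)

lemma interval_index_left:
  assumes "0 < t" "t \<le> real N + 1"
  obtains k where "k \<le> N" "real k < t" "t \<le> real k + 1"
proof
  show "nat (\<lceil>t\<rceil> - 1) \<le> N" "real (nat (\<lceil>t\<rceil> - 1)) < t" "t \<le> real (nat (\<lceil>t\<rceil> - 1)) + 1"
    using assms by linarith+
qed

lemma interval_index_right:
  assumes "0 \<le> t" "t < real N + 1"
  obtains k where "k \<le> N" "real k \<le> t" "t < real k + 1"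
proof
  show "nat \<lfloor>t\<rfloor> \<le> N" "real (nat \<lfloor>t\<rfloor>) \<le> t" "t < real (nat \<lfloor>t\<rfloor>) + 1"
    using assms by linarith+
qed

lemma complex_at_subset: "complex_at N K \<epsilon> v t \<subseteq> K"
  by (auto simp: complex_at_def)

lemma left_complex_subset: "left_complex N K \<epsilon> v t \<subseteq> K"
  by (auto simp: left_complex_def)

lemma eventually_complex_at_left:
  assumes "finite K" "0 < t" "t \<le> real N + 1"
  shows "\<forall>\<^sub>F s in at_left t. complex_at N K \<epsilon> v s = left_complex N K \<epsilon> v t"
proof -
  obtain k where k: "k \<le> N" "real k < t" "t \<le> real k + 1"
    using interval_index_left assms by metis
  have "\<forall>\<^sub>F s in at_left t. \<forall>\<sigma>\<in>K. \<sigma> \<in> complex_at N K \<epsilon> v s \<longleftrightarrow> \<sigma> \<in> left_complex N K \<epsilon> v t"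
  proof (intro eventually_ball_finite[OF assms(1)] ballI)
    fix \<sigma> assume "\<sigma> \<in> K"
    show "\<forall>\<^sub>F s in at_left t. \<sigma> \<in> complex_at N K \<epsilon> v s \<longleftrightarrow> \<sigma> \<in> left_complex N K \<epsilon> v t"
      unfolding left_complex_iff[OF k \<open>\<sigma> \<in> K\<close>] by (rule eventually_left_complex_at[OF k \<open>\<sigma> \<in> K\<close>])
  qed
  then show ?thesis
    by (rule eventually_mono) (use complex_at_subset left_complex_subset in blast)
qed

lemma eventually_complex_at_right:
  assumes "finite K" "0 \<le> t" "t < real N + 1"
  shows "\<forall>\<^sub>F s in at_right t. complex_at N K \<epsilon> v s = complex_at N K \<epsilon> v t"
proof -
  obtain k where k: "k \<le> N" "real k \<le> t" "t < real k + 1"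
    using interval_index_right assms by metis
  have "\<forall>\<^sub>F s in at_right t. \<sigma> \<in> complex_at N K \<epsilon> v s \<longleftrightarrow> \<sigma> \<in> complex_at N K \<epsilon> v t"
    if "\<sigma> \<in> K" for \<sigma>
  proof -
    define b where
      "b = (if t < cross_time \<epsilon> k \<sigma> v then min (real k + 1) (cross_time \<epsilon> k \<sigma> v) else real k + 1)"
    have "t < b" using k by (auto simp: b_def)
    moreover have "\<sigma> \<in> complex_at N K \<epsilon> v s \<longleftrightarrow> \<sigma> \<in> complex_at N K \<epsilon> v t" if "t < s" "s < b" for s
      using complex_at_iff[of k N _ \<sigma> K \<epsilon> v] k \<open>\<sigma> \<in> K\<close> that by (auto simp: b_def split: if_splits)
    ultimately show ?thesis
      unfolding eventually_at_right_field by blast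
  qed
  then have "\<forall>\<^sub>F s in at_right t. \<forall>\<sigma>\<in>K. \<sigma> \<in> complex_at N K \<epsilon> v s \<longleftrightarrow> \<sigma> \<in> complex_at N K \<epsilon> v t"
    by (subst eventually_ball_finite_distrib) (auto simp: assms)
  then show ?thesis
    by (rule eventually_mono) (use complex_at_subset in blast)
qed

section \<open>Jumps of the complex\<close>

text \<open>Just after t the complex always keeps its value at t, so local constancy at t can fail
  on the left only.\<close>

lemma jump_times_iff:
  assumes "finite K"
  shows "t \<in> jump_times N K \<epsilon> v \<longleftrightarrow>
    0 < t \<and> t < real N + 1 \<and> left_complex N K \<epsilon> v t \<noteq> complex_at N K \<epsilon> v t"
proof (cases "0 < t \<and> t < real N + 1")
  case True
  have "(\<forall>\<^sub>F s in at_left t. complex_at N K \<epsilon> v s = complex_at N K \<epsilon> v t) \<longleftrightarrow>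
    (\<forall>\<^sub>F s in at_left t. left_complex N K \<epsilon> v t = complex_at N K \<epsilon> v t)"
    by (rule eventually_cong[OF eventually_complex_at_left[of K t N \<epsilon> v]]) (use assms True in auto)
  also have "\<dots> \<longleftrightarrow> left_complex N K \<epsilon> v t = complex_at N K \<epsilon> v t"
    by (simp add: trivial_limit_at_left_real)
  finally show ?thesis
    using True eventually_complex_at_right[of K t N \<epsilon> v] assms
    by (auto simp: jump_times_def eventually_at_split)
qed (auto simp: jump_times_def)

text \<open>Without jumps the complex is locally constant on the connected set [a, b), hence
  constant. The point a may itself be a jump, since its relative neighbourhoods lie to its
  right.\<close>

lemma left_complex_eq_complex_at:
  assumes "finite K" "0 \<le> a" "a < b" "b \<le> real N + 1"
    and no_jump: "\<And>t. a < t \<Longrightarrow> t < b \<Longrightarrow> t \<notin> jump_times N K \<epsilon> v"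
  shows "left_complex N K \<epsilon> v b = complex_at N K \<epsilon> v a"
proof -
  have "complex_at N K \<epsilon> v constant_on {a..<b}"
  proof (rule locally_constant_imp_constant)
    fix t assume t: "t \<in> {a..<b}"
    have "\<forall>\<^sub>F s in at_right t. complex_at N K \<epsilon> v s = complex_at N K \<epsilon> v t"
      using assms t by (intro eventually_complex_at_right) auto
    then obtain d where d: "d > t" "\<And>s. t < s \<Longrightarrow> s < d \<Longrightarrow> complex_at N K \<epsilon> v s = complex_at N K \<epsilon> v t"
      unfolding eventually_at_right_field by blast
    obtain c where c: "c < t" "\<And>s. s \<in> {a..<b} \<Longrightarrow> c < s \<Longrightarrow> s < t \<Longrightarrow>
        complex_at N K \<epsilon> v s = complex_at N K \<epsilon> v t"
    proof (cases "t = a")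
      case True
      \<comment> \<open>Any point below a serves: no s of the interval lies before t = a.\<close>
      then show ?thesis using that[of "a - 1"] by auto
    next
      case False
      then have "\<forall>\<^sub>F s in at t. complex_at N K \<epsilon> v s = complex_at N K \<epsilon> v t"
        using no_jump[of t] t assms by (auto simp: jump_times_def)
      then have "\<forall>\<^sub>F s in at_left t. complex_at N K \<epsilon> v s = complex_at N K \<epsilon> v t"
        by (simp add: eventually_at_split)
      then show ?thesis using that unfolding eventually_at_left_field by blast
    qed
    have op: "openin (top_of_set {a..<b}) ({a..<b} \<inter> {c<..<d})"
      by (simp add: openin_open_Int)
    have eq: "complex_at N K \<epsilon> v s = complex_at N K \<epsilon> v t" if "s \<in> {a..<b} \<inter> {c<..<d}" for s
      using c(2)[of s] d(2)[of s] that by (cases s t rule: linorder_cases) auto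
    show "\<exists>T. openin (top_of_set {a..<b}) T \<and> t \<in> T \<and>
        (\<forall>s\<in>T. complex_at N K \<epsilon> v s = complex_at N K \<epsilon> v t)"
      using t c(1) d(1) by (intro exI[of _ "{a..<b} \<inter> {c<..<d}"] conjI op ballI eq) auto
  qed auto
  then have const: "complex_at N K \<epsilon> v s = complex_at N K \<epsilon> v a" if "s \<in> {a..<b}" for s
    using that \<open>a < b\<close> by (auto simp: constant_on_def)
  have "\<forall>\<^sub>F s in at_left b. s \<in> {a<..<b}"
    using \<open>a < b\<close> by (intro eventually_at_leftI[of a]) auto
  moreover have "\<forall>\<^sub>F s in at_left b. complex_at N K \<epsilon> v s = left_complex N K \<epsilon> v b"
    using eventually_complex_at_left[of K b N] assms by auto
  ultimately have "\<forall>\<^sub>F s in at_left b. complex_at N K \<epsilon> v a = left_complex N K \<epsilon> v b"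
    by eventually_elim (metis const atLeastLessThan_iff greaterThanLessThan_iff less_imp_le)
  then show ?thesis by (simp add: trivial_limit_at_left_real)
qed

text \<open>The crossings that produce an event. A simplex that exits and re-enters at the integer time
  where it takes the value \<open>\<epsilon>\<close> crosses twice there without changing the complex.\<close>

definition event_crossings ::
    "nat \<Rightarrow> 'v set set \<Rightarrow> real \<Rightarrow> ('v set \<times> nat \<Rightarrow> real) \<Rightarrow> ('v event \<times> nat) set" where
  "event_crossings N K \<epsilon> v =
     {(Ins \<sigma>, k) | \<sigma> k. \<sigma> \<in> K \<and> k \<le> N \<and> entry \<epsilon> v \<sigma> k \<and> \<not> (v (\<sigma>, k) = \<epsilon> \<and> \<epsilon> < v (\<sigma>, k - 1))} \<union>
     {(Del \<sigma>, k) | \<sigma> k. \<sigma> \<in> K \<and> k \<le> N \<and> exit \<epsilon> v \<sigma> k \<and> \<not> (v (\<sigma>, k + 1) = \<epsilon> \<and> \<epsilon> < v (\<sigma>, k + 2))}"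

abbreviation event_time :: "real \<Rightarrow> ('v set \<times> nat \<Rightarrow> real) \<Rightarrow> 'v event \<times> nat \<Rightarrow> real" where
  "event_time \<epsilon> v x \<equiv> cross_time \<epsilon> (snd x) (esimplex (fst x)) v"

section \<open>Event crossings as the origin of all jumps\<close>

lemma finite_event_crossings:
  assumes "finite K" shows "finite (event_crossings N K \<epsilon> v)"
  by (rule finite_subset[of _ "(Ins ` K \<union> Del ` K) \<times> {..N}"])
    (auto simp: event_crossings_def assms)

text \<open>Inside a piece every entry inserts. At an integer k where the value is
  \<open>\<epsilon>\<close>, the piece on the left decides whether \<sigma> was already present just
  before, and that is the case left out of \<open>event_crossings\<close>.\<close>

lemma entering_iff:
  assumes "v \<in> FF N K" "0 < \<epsilon>" "\<sigma> \<in> K"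
  shows "0 < t \<and> t < real N + 1 \<and> \<sigma> \<in> complex_at N K \<epsilon> v t \<and> \<sigma> \<notin> left_complex N K \<epsilon> v t \<longleftrightarrow>
    (\<exists>k. (Ins \<sigma>, k) \<in> event_crossings N K \<epsilon> v \<and> t = cross_time \<epsilon> k \<sigma> v)" (is "?L \<longleftrightarrow> ?R")
proof -
  have v0: "v (\<sigma>, 0) = 0" "v (\<sigma>, Suc N) = 0" using assms FF_boundary by auto
  have interior: "\<sigma> \<in> complex_at N K \<epsilon> v t \<and> \<sigma> \<notin> left_complex N K \<epsilon> v t \<longleftrightarrow>
      entry \<epsilon> v \<sigma> k \<and> t = cross_time \<epsilon> k \<sigma> v" if "k \<le> N" "real k < t" "t < real k + 1" for k
    using complex_at_iff[of k N t \<sigma> K \<epsilon> v] left_complex_iff[of k N t \<sigma> K \<epsilon> v] that assms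
    by (auto simp: entry_def exit_def)
  have integer: "\<sigma> \<in> complex_at N K \<epsilon> v t \<and> \<sigma> \<notin> left_complex N K \<epsilon> v t \<longleftrightarrow>
      entry \<epsilon> v \<sigma> k \<and> v (\<sigma>, k) = \<epsilon> \<and> v (\<sigma>, k - 1) \<le> \<epsilon>" if "k \<le> N" "real k = t" "0 < k" for k
    using complex_at_integer[of k N \<sigma> K \<epsilon> v] left_complex_integer[of "k - 1" N \<sigma> K \<epsilon> v] that assms
    by (auto simp: entry_def of_nat_diff)
  show ?thesis
  proof
    assume ?L
    then obtain k where k: "k \<le> N" "real k \<le> t" "t < real k + 1"
      using interval_index_right by (metis less_imp_le)
    show ?R
    proof (cases "real k = t")
      case True
      then have "entry \<epsilon> v \<sigma> k" "v (\<sigma>, k) = \<epsilon>" "v (\<sigma>, k - 1) \<le> \<epsilon>"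
        using k \<open>?L\<close> integer[of k] by auto
      then show ?thesis
        using True k assms cross_time_entry[of \<epsilon> v \<sigma> k]
        by (intro exI[of _ k]) (auto simp: event_crossings_def)
    next
      case False
      then have "entry \<epsilon> v \<sigma> k" "t = cross_time \<epsilon> k \<sigma> v"
        using k \<open>?L\<close> interior[of k] by auto
      then show ?thesis
        using False k assms cross_time_entry[of \<epsilon> v \<sigma> k]
        by (intro exI[of _ k]) (auto simp: event_crossings_def)
    qed
  next
    assume ?R
    then obtain k where k: "k \<le> N" "entry \<epsilon> v \<sigma> k" "\<not> (v (\<sigma>, k) = \<epsilon> \<and> \<epsilon> < v (\<sigma>, k - 1))"
      "t = cross_time \<epsilon> k \<sigma> v"
      by (auto simp: event_crossings_def)
    have t: "real k \<le> t" "t < real k + 1" "t = real k \<longleftrightarrow> v (\<sigma>, k) = \<epsilon>"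
      using k cross_time_entry[of \<epsilon> v \<sigma> k] by auto
    show ?L
    proof (cases "t = real k")
      case True
      \<comment> \<open>An entry at time 0 would require v (\<sigma>, 0) = \<epsilon>, but this
        value is 0. Hence the subtraction k - 1 is genuine.\<close>
      then have "0 < k" using t v0 assms by (cases "k = 0") auto
      then show ?thesis using True integer[of k] k t by auto
    next
      case False
      then show ?thesis using interior[of k] k t by auto
    qed
  qed
qed

text \<open>Mirror image of the entering case: an exit that ends at height \<open>\<epsilon>\<close>
  takes place at the right end of its piece, so pieces are now (k, k + 1], and the value 0 at N + 1
  excludes the last endpoint.\<close>

lemma leaving_iff:
  assumes "v \<in> FF N K" "0 < \<epsilon>" "\<sigma> \<in> K"
  shows "0 < t \<and> t < real N + 1 \<and> \<sigma> \<notin> complex_at N K \<epsilon> v t \<and> \<sigma> \<in> left_complex N K \<epsilon> v t \<longleftrightarrow>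
    (\<exists>k. (Del \<sigma>, k) \<in> event_crossings N K \<epsilon> v \<and> t = cross_time \<epsilon> k \<sigma> v)" (is "?L \<longleftrightarrow> ?R")
proof -
  have v0: "v (\<sigma>, 0) = 0" "v (\<sigma>, Suc N) = 0" using assms FF_boundary by auto
  have interior: "\<sigma> \<notin> complex_at N K \<epsilon> v t \<and> \<sigma> \<in> left_complex N K \<epsilon> v t \<longleftrightarrow>
      exit \<epsilon> v \<sigma> k \<and> t = cross_time \<epsilon> k \<sigma> v" if "k \<le> N" "real k < t" "t < real k + 1" for k
    using complex_at_iff[of k N t \<sigma> K \<epsilon> v] left_complex_iff[of k N t \<sigma> K \<epsilon> v] that assms
    by (auto simp: entry_def exit_def)
  have integer: "\<sigma> \<notin> complex_at N K \<epsilon> v t \<and> \<sigma> \<in> left_complex N K \<epsilon> v t \<longleftrightarrow>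
      exit \<epsilon> v \<sigma> k \<and> v (\<sigma>, k + 1) = \<epsilon> \<and> v (\<sigma>, k + 2) \<le> \<epsilon>" if "k < N" "real k + 1 = t" for k
    using complex_at_integer[of "k + 1" N \<sigma> K \<epsilon> v] left_complex_integer[of k N \<sigma> K \<epsilon> v] that assms
    by (auto simp: exit_def add.commute)
  show ?thesis
  proof
    assume ?L
    then obtain k where k: "k \<le> N" "real k < t" "t \<le> real k + 1"
      using interval_index_left by (metis less_imp_le)
    show ?R
    proof (cases "real k + 1 = t")
      case True
      then have "exit \<epsilon> v \<sigma> k" "v (\<sigma>, k + 1) = \<epsilon>" "v (\<sigma>, k + 2) \<le> \<epsilon>"
        using k \<open>?L\<close> integer[of k] by auto
      then show ?thesis
        using True k assms cross_time_exit[of \<epsilon> v \<sigma> k]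
        by (intro exI[of _ k]) (auto simp: event_crossings_def)
    next
      case False
      then have "exit \<epsilon> v \<sigma> k" "t = cross_time \<epsilon> k \<sigma> v"
        using k \<open>?L\<close> interior[of k] by auto
      then show ?thesis
        using False k assms cross_time_exit[of \<epsilon> v \<sigma> k]
        by (intro exI[of _ k]) (auto simp: event_crossings_def)
    qed
  next
    assume ?R
    then obtain k where k: "k \<le> N" "exit \<epsilon> v \<sigma> k" "\<not> (v (\<sigma>, k + 1) = \<epsilon> \<and> \<epsilon> < v (\<sigma>, k + 2))"
      "t = cross_time \<epsilon> k \<sigma> v"
      by (auto simp: event_crossings_def)
    have t: "real k < t" "t \<le> real k + 1" "t = real k + 1 \<longleftrightarrow> v (\<sigma>, k + 1) = \<epsilon>"
      using k cross_time_exit[of \<epsilon> v \<sigma> k] by auto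
    show ?L
    proof (cases "t = real k + 1")
      case True
      then have "k < N" using t v0 assms k(1) by (cases "k = N") auto
      then show ?thesis using True integer[of k] k t by auto
    next
      case False
      then show ?thesis using interior[of k] k t by auto
    qed
  qed
qed

text \<open>Every jump is the time of some event crossing. Finiteness is what makes
  \<open>sorted_list_of_set\<close> in \<open>complex_seq\<close> list the jump times.\<close>

lemma finite_jump_times:
  assumes "finite K" "v \<in> FF N K" "0 < \<epsilon>"
  shows "finite (jump_times N K \<epsilon> v)"
proof (rule finite_subset)
  show "jump_times N K \<epsilon> v \<subseteq> event_time \<epsilon> v ` event_crossings N K \<epsilon> v"
  proof
    fix t assume t: "t \<in> jump_times N K \<epsilon> v"
    then obtain \<sigma> where "\<sigma> \<in> K" "\<sigma> \<in> complex_at N K \<epsilon> v t \<longleftrightarrow> \<sigma> \<notin> left_complex N K \<epsilon> v t"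
      using complex_at_subset[of N K \<epsilon> v t] left_complex_subset[of N K \<epsilon> v t]
      unfolding jump_times_iff[OF assms(1)] by blast
    with t entering_iff[OF assms(2,3), of \<sigma> t] leaving_iff[OF assms(2,3), of \<sigma> t] assms(1)
    show "t \<in> event_time \<epsilon> v ` event_crossings N K \<epsilon> v"
      by (force simp: jump_times_iff)
  qed
qed (intro finite_imageI finite_event_crossings assms)

text \<open>\<open>timed_events\<close> compares the complex at a jump time with that at the
  preceding one. Nothing changes in between, so the latter is the left limit, and the differences
  consist of the entering and the leaving simplices.\<close>

lemma timed_events_complex_seq:
  assumes "finite K" "v \<in> FF N K" "0 < \<epsilon>"
  shows "timed_events (complex_seq N K \<epsilon> v) =
    (\<lambda>x. (event_time \<epsilon> v x, fst x)) ` event_crossings N K \<epsilon> v"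
proof -
  \<comment> \<open>Position 0 holds the initial time, which is not a jump time; the jump times
    occupy the positions from 1 on.\<close>
  define ts where "ts = 0 # sorted_list_of_set (jump_times N K \<epsilon> v)"
  have set_ts: "set (tl ts) = jump_times N K \<epsilon> v"
    using finite_jump_times[OF assms] by (simp add: ts_def)
  have pos: "0 < t \<and> t < real N + 1" if "t \<in> jump_times N K \<epsilon> v" for t
    using that by (auto simp: jump_times_def)
  have "sorted_wrt (<) ts"
    using finite_jump_times[OF assms] pos by (auto simp: ts_def)
  then have mono: "i < j \<Longrightarrow> j < length ts \<Longrightarrow> ts ! i < ts ! j" for i j
    by (simp add: sorted_wrt_nth_less)
  have jump: "ts ! i \<in> jump_times N K \<epsilon> v" if "1 \<le> i" "i < length ts" for i
    using that set_ts nth_mem[of "i - 1" "tl ts"] by (simp add: nth_tl)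
  have jumpE: "\<exists>i. 1 \<le> i \<and> i < length ts \<and> t = ts ! i" if t: "t \<in> jump_times N K \<epsilon> v" for t
  proof -
    obtain j where "j < length (tl ts)" "t = tl ts ! j"
      using t set_ts by (metis in_set_conv_nth)
    then show ?thesis by (intro exI[of _ "Suc j"]) (auto simp: ts_def)
  qed
  have prev: "complex_at N K \<epsilon> v (ts ! (i - 1)) = left_complex N K \<epsilon> v (ts ! i)"
    if i: "1 \<le> i" "i < length ts" for i
  proof (rule left_complex_eq_complex_at[symmetric])
    have "ts ! (i - 1) = 0 \<or> ts ! (i - 1) \<in> jump_times N K \<epsilon> v"
      using jump[of "i - 1"] i by (cases "i = 1") (auto simp: ts_def)
    then show "0 \<le> ts ! (i - 1)" using pos by force
    show "ts ! (i - 1) < ts ! i" using mono i by auto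
    show "ts ! i \<le> real N + 1" using pos jump i by force
    fix t assume t: "ts ! (i - 1) < t" "t < ts ! i"
    show "t \<notin> jump_times N K \<epsilon> v"
    proof
      assume "t \<in> jump_times N K \<epsilon> v"
      then obtain j where j: "j < length ts" "t = ts ! j" using jumpE by blast
      then have "\<not> j \<le> i - 1" using t(1) mono[of j "i - 1"] i
        by (metis One_nat_def Suc_pred diff_less le_less less_trans less_asym zero_less_one less_le_trans)
      moreover have "\<not> i \<le> j" using t(2) mono[of i j] j by (metis le_less less_asym)
      ultimately show False by auto
    qed
  qed (fact assms)
  have "(t, a) \<in> timed_events (complex_seq N K \<epsilon> v) \<longleftrightarrow> t \<in> jump_times N K \<epsilon> v \<and>
      a \<in> Ins ` (complex_at N K \<epsilon> v t - left_complex N K \<epsilon> v t) \<union>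
          Del ` (left_complex N K \<epsilon> v t - complex_at N K \<epsilon> v t)" (is "_ \<longleftrightarrow> ?J") for t a
  proof -
    let ?xs = "map (\<lambda>T. (T, complex_at N K \<epsilon> v T)) ts"
    have "(t, a) \<in> timed_events (complex_seq N K \<epsilon> v) \<longleftrightarrow>
      (\<exists>i. 1 \<le> i \<and> i < length ts \<and> t = fst (?xs ! i) \<and>
        a \<in> Ins ` (snd (?xs ! i) - snd (?xs ! (i - 1))) \<union> Del ` (snd (?xs ! (i - 1)) - snd (?xs ! i)))"
      unfolding timed_events_def complex_seq_def ts_def[symmetric] mem_Collect_eq prod.inject length_map
      by blast
    also have "\<dots> \<longleftrightarrow> (\<exists>i. 1 \<le> i \<and> i < length ts \<and> t = ts ! i \<and>
      a \<in> Ins ` (complex_at N K \<epsilon> v (ts ! i) - complex_at N K \<epsilon> v (ts ! (i - 1))) \<union>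
          Del ` (complex_at N K \<epsilon> v (ts ! (i - 1)) - complex_at N K \<epsilon> v (ts ! i)))"
      by (simp cong: conj_cong)
    also have "\<dots> \<longleftrightarrow> ?J" using prev jump jumpE by metis
    finally show ?thesis .
  qed
  also have "?J t a \<longleftrightarrow> (\<exists>k. (a, k) \<in> event_crossings N K \<epsilon> v \<and> t = cross_time \<epsilon> k (esimplex a) v)" for t a
  proof (cases "esimplex a \<in> K")
    case True
    then show ?thesis
      using entering_iff[OF assms(2,3) True, of t] leaving_iff[OF assms(2,3) True, of t]
      by (cases a) (auto simp: jump_times_iff[OF assms(1)])
  next
    case False
    then have "a \<notin> Ins ` K" "a \<notin> Del ` K" "\<And>k. (a, k) \<notin> event_crossings N K \<epsilon> v"
      by (auto simp: event_crossings_def)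
    then show ?thesis
      using complex_at_subset[of N K \<epsilon> v t] left_complex_subset[of N K \<epsilon> v t] by blast
  qed
  also have "(\<exists>k. (a, k) \<in> event_crossings N K \<epsilon> v \<and> t = cross_time \<epsilon> k (esimplex a) v) \<longleftrightarrow>
      (t, a) \<in> (\<lambda>x. (event_time \<epsilon> v x, fst x)) ` event_crossings N K \<epsilon> v" for t a
    by (force simp: image_iff)
  finally show ?thesis by auto
qed

section \<open>Invariance of the events and their order along a cell\<close>

lemma cell_sgn:
  assumes "v \<in> FF N K" "w \<in> cell N K \<epsilon> v" "k \<le> Suc N"
  shows "sgn (w (\<sigma>, k) - \<epsilon>) = sgn (v (\<sigma>, k) - \<epsilon>)"
proof (cases "k = 0 \<or> k = Suc N \<or> \<sigma> \<notin> K")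
  case True
  then show ?thesis using assms FF_boundary[of v N K \<sigma>] FF_boundary[of w N K \<sigma>] by (auto simp: cell_def)
next
  case False
  then show ?thesis using assms by (auto simp: cell_def)
qed

lemma cell_compare:
  assumes "v \<in> FF N K" "w \<in> cell N K \<epsilon> v" "k \<le> Suc N"
  shows "\<epsilon> < w (\<sigma>, k) \<longleftrightarrow> \<epsilon> < v (\<sigma>, k)" "w (\<sigma>, k) = \<epsilon> \<longleftrightarrow> v (\<sigma>, k) = \<epsilon>"
  using cell_sgn[OF assms, of \<sigma>] by (auto simp: sgn_if split: if_splits)

lemma cell_entry_exit:
  assumes "v \<in> FF N K" "w \<in> cell N K \<epsilon> v" "k \<le> N"
  shows "entry \<epsilon> w \<sigma> k \<longleftrightarrow> entry \<epsilon> v \<sigma> k" "exit \<epsilon> w \<sigma> k \<longleftrightarrow> exit \<epsilon> v \<sigma> k"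
  using cell_compare[OF assms(1,2), of k \<sigma>] cell_compare[OF assms(1,2), of "k + 1" \<sigma>] assms(3)
  by (auto simp: entry_def exit_def not_less)

lemma event_crossings_cell:
  assumes "v \<in> FF N K" "0 < \<epsilon>" and w: "w \<in> cell N K \<epsilon> v"
  shows "event_crossings N K \<epsilon> w = event_crossings N K \<epsilon> v"
proof -
  \<comment> \<open>For k = N the index k + 2 is out of range of \<open>cell_compare\<close>; there
    the value 0 at N + 1 rules out equality with \<open>\<epsilon>\<close> for both
    functions.\<close>
  have next_eq: "w (\<sigma>, k + 1) = \<epsilon> \<and> \<epsilon> < w (\<sigma>, k + 2) \<longleftrightarrow> v (\<sigma>, k + 1) = \<epsilon> \<and> \<epsilon> < v (\<sigma>, k + 2)" if "k \<le> N" for k \<sigma>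
  proof (cases "k = N")
    case True
    then show ?thesis using assms FF_boundary[of v N K \<sigma>] FF_boundary[of w N K \<sigma>] by (auto simp: cell_def)
  next
    case False
    then show ?thesis using that cell_compare[OF assms(1) w, of _ \<sigma>] by simp
  qed
  have prev_eq: "w (\<sigma>, k) = \<epsilon> \<and> \<epsilon> < w (\<sigma>, k - 1) \<longleftrightarrow> v (\<sigma>, k) = \<epsilon> \<and> \<epsilon> < v (\<sigma>, k - 1)" if "k \<le> N" for k \<sigma>
    using that cell_compare[OF assms(1) w, of _ \<sigma>] by simp
  have "(a, k) \<in> event_crossings N K \<epsilon> w \<longleftrightarrow> (a, k) \<in> event_crossings N K \<epsilon> v" for a k
  proof (cases "k \<le> N")
    case True
    show ?thesis
      using cell_entry_exit[OF assms(1) w True, of "esimplex a"] next_eq[OF True, of "esimplex a"]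
        prev_eq[OF True, of "esimplex a"]
      by (cases a) (auto simp: event_crossings_def)
  qed (auto simp: event_crossings_def)
  then show ?thesis by auto
qed

lemma event_crossings_crosses:
  "x \<in> event_crossings N K \<epsilon> v \<Longrightarrow>
    esimplex (fst x) \<in> K \<and> snd x \<le> N \<and> crosses \<epsilon> v (esimplex (fst x)) (snd x)"
  by (auto simp: event_crossings_def crosses_def)

lemma cross_time_bounds:
  assumes "crosses \<epsilon> v \<sigma> k"
  shows "real k \<le> cross_time \<epsilon> k \<sigma> v" "cross_time \<epsilon> k \<sigma> v \<le> real k + 1"
    "cross_time \<epsilon> k \<sigma> v = real k \<longleftrightarrow> v (\<sigma>, k) = \<epsilon>"
    "cross_time \<epsilon> k \<sigma> v = real k + 1 \<longleftrightarrow> v (\<sigma>, k + 1) = \<epsilon>"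
  using assms cross_time_entry[of \<epsilon> v \<sigma> k] cross_time_exit[of \<epsilon> v \<sigma> k]
  by (auto simp: crosses_def entry_def exit_def)

text \<open>For \<open>k \<noteq> l\<close> the crossing times lie in different unit intervals, so that they agree only if
  both are the common endpoint, which can be read off from the signs.\<close>

lemma cell_cross_time_less:
  assumes v: "v \<in> FF N K" and w: "w \<in> cell N K \<epsilon> v"
    and \<sigma>: "\<sigma> \<in> K" "k \<le> N" "crosses \<epsilon> v \<sigma> k" and \<tau>: "\<tau> \<in> K" "l \<le> N" "crosses \<epsilon> v \<tau> l"
  shows "cross_time \<epsilon> k \<sigma> w < cross_time \<epsilon> l \<tau> w \<longleftrightarrow> cross_time \<epsilon> k \<sigma> v < cross_time \<epsilon> l \<tau> v"
proof -
  have cw: "crosses \<epsilon> w \<sigma> k" "crosses \<epsilon> w \<tau> l"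
    using assms cell_entry_exit[OF v w] by (auto simp: crosses_def)
  note b = cross_time_bounds[OF \<sigma>(3)] cross_time_bounds[OF \<tau>(3)]
    cross_time_bounds[OF cw(1)] cross_time_bounds[OF cw(2)]
  consider "k = l" | "k + 1 = l" | "k + 1 < l" | "l < k" by linarith
  then show ?thesis
  proof cases
    case 1
    have "\<forall>k\<in>{0..N}. \<forall>\<sigma>\<in>K. \<forall>\<tau>\<in>K. crosses \<epsilon> v \<sigma> k \<and> crosses \<epsilon> v \<tau> k \<longrightarrow>
        (cross_time \<epsilon> k \<sigma> w < cross_time \<epsilon> k \<tau> w \<longleftrightarrow> cross_time \<epsilon> k \<sigma> v < cross_time \<epsilon> k \<tau> v)"
      using w unfolding cell_def by blast
    then show ?thesis using 1 \<sigma> \<tau> by simp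
  next
    case 2
    have "w (\<sigma>, k + 1) = \<epsilon> \<longleftrightarrow> v (\<sigma>, k + 1) = \<epsilon>" "w (\<tau>, l) = \<epsilon> \<longleftrightarrow> v (\<tau>, l) = \<epsilon>"
      using cell_compare[OF v w] \<sigma> \<tau> by auto
    moreover have "real l = real k + 1" using 2 by auto
    then have "cross_time \<epsilon> k \<sigma> u < cross_time \<epsilon> l \<tau> u \<longleftrightarrow>
        cross_time \<epsilon> k \<sigma> u \<noteq> real k + 1 \<or> cross_time \<epsilon> l \<tau> u \<noteq> real l"
      if "crosses \<epsilon> u \<sigma> k" "crosses \<epsilon> u \<tau> l" for u
      using cross_time_bounds(2)[OF that(1)] cross_time_bounds(1)[OF that(2)] by linarith
    ultimately show ?thesis using b cw \<sigma>(3) \<tau>(3) by simp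
  next
    case 3
    then have "real k + 1 < real l" by linarith
    then have "cross_time \<epsilon> k \<sigma> v < cross_time \<epsilon> l \<tau> v" "cross_time \<epsilon> k \<sigma> w < cross_time \<epsilon> l \<tau> w"
      using b(2,5,10,13) by linarith+
    then show ?thesis by simp
  next
    case 4
    then have "real l + 1 \<le> real k" by linarith
    then have "\<not> cross_time \<epsilon> k \<sigma> v < cross_time \<epsilon> l \<tau> v" "\<not> cross_time \<epsilon> k \<sigma> w < cross_time \<epsilon> l \<tau> w"
      using b(1,6,9,14) by linarith+
    then show ?thesis by simp
  qed
qed

text \<open>Entry times lie in [k, k + 1) and exit times in (k, k + 1]. For each kind these
  intervals are disjoint, so kind and time determine the piece.\<close>

lemma event_index_unique:
  assumes "if is_insertion a then entry \<epsilon> v (esimplex a) k else exit \<epsilon> v (esimplex a) k"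
    and "if is_insertion a then entry \<epsilon> v (esimplex a) l else exit \<epsilon> v (esimplex a) l"
    and "cross_time \<epsilon> k (esimplex a) v = cross_time \<epsilon> l (esimplex a) v"
  shows "k = l"
  using assms cross_time_entry[of \<epsilon> v "esimplex a" k] cross_time_entry[of \<epsilon> v "esimplex a" l]
    cross_time_exit[of \<epsilon> v "esimplex a" k] cross_time_exit[of \<epsilon> v "esimplex a" l]
  by (auto split: if_splits)

lemma event_crossings_entry_exit:
  "x \<in> event_crossings N K \<epsilon> v \<Longrightarrow>
    if is_insertion (fst x) then entry \<epsilon> v (esimplex (fst x)) (snd x)
    else exit \<epsilon> v (esimplex (fst x)) (snd x)"
  by (auto simp: event_crossings_def)

text \<open>Keeps the list of timed events free of repetitions, as \<open>encode\<close>
  demands.\<close>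

lemma inj_on_event_crossings:
  "inj_on (\<lambda>x. (event_time \<epsilon> v x, fst x)) (event_crossings N K \<epsilon> v)"
proof (rule inj_onI)
  fix x y assume xy: "x \<in> event_crossings N K \<epsilon> v" "y \<in> event_crossings N K \<epsilon> v"
    "(event_time \<epsilon> v x, fst x) = (event_time \<epsilon> v y, fst y)"
  then obtain a k l where eq: "x = (a, k)" "y = (a, l)" by (cases x; cases y) auto
  have "k = l"
    using xy event_crossings_entry_exit[of "(a, k)" N K \<epsilon> v] event_crossings_entry_exit[of "(a, l)" N K \<epsilon> v]
    unfolding eq fst_conv snd_conv by (intro event_index_unique[of a \<epsilon> v k l]) simp_all
  then show "x = y" by (simp add: eq)
qed

section \<open>Sorted enumerations and the encoding of events\<close>

text \<open>If the heads differed, each would occur in the tail of the other list and so precede the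
  other; antisymmetry on the set forbids this.\<close>

lemma sorted_wrt_distinct_unique:
  assumes "sorted_wrt P xs" "sorted_wrt P ys" "distinct xs" "distinct ys" "set xs = set ys"
    and "\<And>x y. x \<in> set xs \<Longrightarrow> y \<in> set xs \<Longrightarrow> P x y \<Longrightarrow> P y x \<Longrightarrow> x = y"
  shows "xs = ys"
  using assms
proof (induction xs arbitrary: ys)
  case (Cons x xs)
  then obtain y ys' where ys: "ys = y # ys'" by (cases ys) auto
  have "x = y"
  proof (rule ccontr)
    assume "x \<noteq> y"
    then have "x \<in> set ys'" "y \<in> set xs" using Cons.prems(5) ys by auto
    then show False using Cons.prems(1,2) Cons.prems(6)[of x y] ys \<open>x \<noteq> y\<close> by simp
  qed
  moreover have "set xs = set ys'"
    using Cons.prems(3-5) unfolding ys \<open>x = y\<close> by (simp add: insert_ident)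
  then have "xs = ys'"
    using Cons.prems ys by (intro Cons.IH) simp_all
  ultimately show ?case using ys by simp
qed auto

text \<open>Insertion with the new element a as pivot: the elements related to a go before it, the
  others after it, and transitivity through a compares the two groups.\<close>

lemma sorted_wrt_list_exists:
  assumes "finite A" "\<And>x y. x \<in> A \<Longrightarrow> y \<in> A \<Longrightarrow> x \<noteq> y \<Longrightarrow> P x y \<or> P y x"
    and "\<And>x y z. x \<in> A \<Longrightarrow> y \<in> A \<Longrightarrow> z \<in> A \<Longrightarrow> P x y \<Longrightarrow> P y z \<Longrightarrow> P x z"
  shows "\<exists>xs. distinct xs \<and> set xs = A \<and> sorted_wrt P xs"
  using assms
proof (induction A rule: finite_induct)
  case empty
  show ?case by simp
next
  case (insert a A)
  have "\<exists>xs. distinct xs \<and> set xs = A \<and> sorted_wrt P xs"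
    by (rule insert.IH) (use insert.prems in blast)+
  then obtain xs where xs: "distinct xs" "set xs = A" "sorted_wrt P xs" by blast
  let ?L = "filter (\<lambda>x. P x a) xs" and ?R = "filter (\<lambda>x. \<not> P x a) xs"
  have R: "P a x" if "x \<in> A" "\<not> P x a" for x
    using insert.prems(1)[of a x] insert.hyps that by auto
  have "P x y" if "x \<in> A" "y \<in> A" "P x a" "\<not> P y a" for x y
    using insert.prems(2)[of x a y] R that by simp
  then have "sorted_wrt P (?L @ a # ?R)"
    using xs R by (simp add: sorted_wrt_append sorted_wrt_filter)
  moreover have "distinct (?L @ a # ?R)" "set (?L @ a # ?R) = insert a A"
    using xs insert.hyps by auto
  ultimately show ?case by blast
qed

abbreviation timed_event_le :: "'v event rel \<Rightarrow> real \<times> 'v event \<Rightarrow> real \<times> 'v event \<Rightarrow> bool" where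
  "timed_event_le R \<equiv> \<lambda>(s, a) (t, b). s < t \<or> s = t \<and> (a, b) \<in> R"

text \<open>Antisymmetry of R makes the sorted enumeration unique, so any candidate list is the one
  that \<open>encode\<close> describes.\<close>

lemma encode_eqI:
  assumes "antisym R" "distinct ys" "set ys = timed_events xs" "sorted_wrt (timed_event_le R) ys"
  shows "encode R xs = ys"
  unfolding encode_def
proof (rule the_equality)
  fix zs assume zs: "distinct zs \<and> set zs = timed_events xs \<and> sorted_wrt (timed_event_le R) zs"
  show "zs = ys"
    by (rule sorted_wrt_distinct_unique[of "timed_event_le R"])
      (use assms zs in \<open>auto dest: antisymD\<close>)
qed (use assms in auto)

text \<open>One list of crossings, sorted once for v, serves for all w. Strict comparisons of times
  are invariant on the cell in both directions, so ties are too, and R breaks them in the same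
  way.\<close>

lemma S_cell:
  assumes "finite K" "0 < \<epsilon>" "event_order K R" and v: "v \<in> FF N K"
  obtains cs where "set cs = event_crossings N K \<epsilon> v"
    "\<And>w. w \<in> cell N K \<epsilon> v \<Longrightarrow> S N K \<epsilon> R w = map (\<lambda>x. (event_time \<epsilon> w x, fst x)) cs"
proof -
  let ?E = "event_crossings N K \<epsilon> v" and ?h = "\<lambda>w x. (event_time \<epsilon> w x, fst x)"
  have lin: "linear_order_on (Ins ` K \<union> Del ` K) R" using assms by (simp add: event_order_def)
  then have R: "antisym R" "trans R" "total_on (Ins ` K \<union> Del ` K) R" "refl_on (Ins ` K \<union> Del ` K) R"
    by (auto simp: order_on_defs)
  have ev: "fst x \<in> Ins ` K \<union> Del ` K" if "x \<in> ?E" for x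
    using that by (auto simp: event_crossings_def)
  have "\<exists>cs. distinct cs \<and> set cs = ?E \<and> sorted_wrt (\<lambda>x y. timed_event_le R (?h v x) (?h v y)) cs"
  proof (rule sorted_wrt_list_exists)
    fix x y assume "x \<in> ?E" "y \<in> ?E" "x \<noteq> y"
    then have "(fst x, fst y) \<in> R \<or> (fst y, fst x) \<in> R"
      using R(3) R(4)[THEN refl_onD] ev unfolding total_on_def by metis
    then show "timed_event_le R (?h v x) (?h v y) \<or> timed_event_le R (?h v y) (?h v x)"
      by auto
  qed (use finite_event_crossings[OF assms(1)] R(2) in \<open>auto dest: transD\<close>)
  then obtain cs where cs: "distinct cs" "set cs = ?E"
    "sorted_wrt (\<lambda>x y. timed_event_le R (?h v x) (?h v y)) cs" by blast
  have "S N K \<epsilon> R w = map (?h w) cs" if w: "w \<in> cell N K \<epsilon> v" for w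
    unfolding S_def
  proof (rule encode_eqI)
    have "event_crossings N K \<epsilon> w = ?E" using event_crossings_cell assms w by metis
    moreover have "w \<in> FF N K" using w by (simp add: cell_def)
    ultimately show "set (map (?h w) cs) = timed_events (complex_seq N K \<epsilon> w)"
      using timed_events_complex_seq[of K w N \<epsilon>] assms cs by auto
    show "distinct (map (?h w) cs)"
      using cs inj_on_event_crossings[of \<epsilon> w N K] \<open>event_crossings N K \<epsilon> w = ?E\<close>
      by (simp add: distinct_map)
    have less: "event_time \<epsilon> w x < event_time \<epsilon> w y \<longleftrightarrow> event_time \<epsilon> v x < event_time \<epsilon> v y"
      if "x \<in> ?E" "y \<in> ?E" for x y
      using cell_cross_time_less[OF v w] event_crossings_crosses[OF that(1)]
        event_crossings_crosses[OF that(2)] by blast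
    have "timed_event_le R (?h w x) (?h w y)"
      if "x \<in> ?E" "y \<in> ?E" "timed_event_le R (?h v x) (?h v y)" for x y
      using less[OF that(1,2)] less[OF that(2,1)] that(3) by auto
    then show "sorted_wrt (timed_event_le R) (map (?h w) cs)"
      unfolding sorted_wrt_map using cs(2) by (intro sorted_wrt_mono_rel[OF _ cs(3)]) blast
  qed (fact R)
  with cs that show ?thesis by blast
qed

section \<open>Differential calculus on \<open>euclid J\<close>\<close>

lemma euclid_points_iff: "x \<in> euclid_points J \<longleftrightarrow> (\<forall>i. i \<notin> J \<longrightarrow> x i = 0)"
  by (simp add: euclid_def)

lemma euclid_points_linear:
  assumes "x \<in> euclid_points J" "y \<in> euclid_points J"
  shows "(\<lambda>i. x i + y i) \<in> euclid_points J" "(\<lambda>i. x i - y i) \<in> euclid_points J"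
    "(\<lambda>i. c * x i) \<in> euclid_points J"
  using assms by (simp_all add: euclid_points_iff)

text \<open>The minimum of finitely many radii; the value 1 covers an empty index set, as in
  dimension 0.\<close>

lemma finite_common_bound:
  assumes "finite A" "\<And>i. i \<in> A \<Longrightarrow> \<exists>d>0. P i d" "\<And>i d d'. P i d \<Longrightarrow> d' \<le> d \<Longrightarrow> P i d'"
  shows "\<exists>d>0::real. \<forall>i\<in>A. P i d"
  using assms(1,2)
proof (induction A rule: finite_induct)
  case empty
  show ?case by (rule exI[of _ 1]) simp
next
  case (insert a A)
  have "\<exists>d>0. \<forall>i\<in>A. P i d" by (rule insert.IH) (use insert.prems in blast)
  then obtain d where d: "d > 0" "\<forall>i\<in>A. P i d" by blast
  obtain d' where "d' > 0" "P a d'" using insert.prems by blast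
  then have "min d d' > 0" "\<forall>i\<in>insert a A. P i (min d d')"
    using d assms(3) by auto
  then show ?case by blast
qed

text \<open>Coordinates outside J vanish in every point of the space, so a basic product
  neighbourhood constrains only the finitely many coordinates in J.\<close>

lemma openin_euclid_box:
  assumes "finite J" "openin (euclid J) W" "x \<in> W"
  shows "\<exists>d>0. \<forall>y\<in>euclid_points J. (\<forall>i\<in>J. \<bar>y i - x i\<bar> < d) \<longrightarrow> y \<in> W"
proof -
  have x: "x \<in> euclid_points J" using assms openin_subset by blast
  obtain T where T: "openin (powertop_real UNIV) T" "W = T \<inter> {x. \<forall>i. i \<notin> J \<longrightarrow> x i = 0}"
    using assms(2) unfolding euclid_def openin_subtopology by blast
  then have "x \<in> T" using assms(3) by auto
  then obtain V where "\<forall>i\<in>UNIV. openin euclideanreal (V i)"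
    and V: "x \<in> Pi\<^sub>E UNIV V" "Pi\<^sub>E UNIV V \<subseteq> T"
    using T(1)[unfolded openin_product_topology_alt] by blast
  then have op: "open (V i)" for i by simp
  have "\<exists>d>0. \<forall>i\<in>J. \<forall>z. \<bar>z - x i\<bar> < d \<longrightarrow> z \<in> V i"
  proof (rule finite_common_bound[OF assms(1)])
    fix i
    have "x i \<in> V i" using V(1) by auto
    then obtain d where "d > 0" "ball (x i) d \<subseteq> V i"
      using op open_contains_ball by metis
    then show "\<exists>d>0. \<forall>z. \<bar>z - x i\<bar> < d \<longrightarrow> z \<in> V i"
      by (intro exI[of _ d]) (auto simp: dist_real_def abs_minus_commute subset_iff)
  qed (meson order_less_le_trans)
  then obtain d where d: "d > 0" "\<And>i z. i \<in> J \<Longrightarrow> \<bar>z - x i\<bar> < d \<Longrightarrow> z \<in> V i" by blast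
  have "y \<in> W" if y: "y \<in> euclid_points J" "\<forall>i\<in>J. \<bar>y i - x i\<bar> < d" for y
  proof -
    have "y i \<in> V i" for i
    proof (cases "i \<in> J")
      case False
      then have "y i = x i" using x y(1) by (simp add: euclid_points_iff)
      then show ?thesis using V(1) by auto
    qed (use d y in auto)
    then have "y \<in> T" using V(2) by auto
    then show ?thesis using T(2) y(1) by (simp add: euclid_points_iff)
  qed
  then show ?thesis using d(1) by blast
qed

lemma continuous_map_euclid_box:
  assumes "finite J" "openin (euclid J) W" "x \<in> W"
    and g: "continuous_map (subtopology (euclid J) W) euclideanreal g" and "0 < e"
  shows "\<exists>d>0. \<forall>y\<in>euclid_points J. (\<forall>i\<in>J. \<bar>y i - x i\<bar> < d) \<longrightarrow> y \<in> W \<and> \<bar>g y - g x\<bar> < e"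
proof -
  have W: "W \<subseteq> euclid_points J" using assms(2) openin_subset by blast
  have "openin (subtopology (euclid J) W) {y \<in> topspace (subtopology (euclid J) W). g y \<in> ball (g x) e}"
    by (rule openin_continuous_map_preimage[OF g]) simp
  moreover have "{y \<in> topspace (subtopology (euclid J) W). g y \<in> ball (g x) e} = {y \<in> W. g y \<in> ball (g x) e}"
    using W by auto
  ultimately have "openin (euclid J) {y \<in> W. g y \<in> ball (g x) e}"
    using assms(2) openin_trans_full by fastforce
  moreover have "x \<in> {y \<in> W. g y \<in> ball (g x) e}" using assms by simp
  ultimately show ?thesis
    using openin_euclid_box[OF assms(1)] by (fastforce simp: dist_real_def abs_minus_commute)
qed

section \<open>Existence, uniqueness and composition of differentials\<close>

text \<open>The path from x to y changes one coordinate at a time, and the mean value estimate is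
  applied on each segment. Continuity keeps every partial derivative within e of its value at
  x.\<close>

lemma C1_increment:
  assumes J: "finite J" and W: "openin (euclid J) W" "x \<in> W" and "0 < e"
    and deriv: "\<And>i y. i \<in> J \<Longrightarrow> y \<in> W \<Longrightarrow> ((\<lambda>t. g (y(i := t))) has_real_derivative g' i y) (at (y i))"
    and cont: "\<And>i. i \<in> J \<Longrightarrow> continuous_map (subtopology (euclid J) W) euclideanreal (g' i)"
  shows "\<exists>d>0. \<forall>y\<in>W. (\<forall>i\<in>J. \<bar>y i - x i\<bar> < d) \<longrightarrow>
    \<bar>g y - g x - (\<Sum>i\<in>J. g' i x * (y i - x i))\<bar> \<le> e * (\<Sum>i\<in>J. \<bar>y i - x i\<bar>)"
proof -
  have WJ: "W \<subseteq> euclid_points J" using W openin_subset by blast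
  have "\<exists>d>0. \<forall>i\<in>J. \<forall>y\<in>euclid_points J. (\<forall>j\<in>J. \<bar>y j - x j\<bar> < d) \<longrightarrow> \<bar>g' i y - g' i x\<bar> < e"
  proof (rule finite_common_bound[OF J])
    fix i assume "i \<in> J"
    then show "\<exists>d>0. \<forall>y\<in>euclid_points J. (\<forall>j\<in>J. \<bar>y j - x j\<bar> < d) \<longrightarrow> \<bar>g' i y - g' i x\<bar> < e"
      using continuous_map_euclid_box[OF J W cont \<open>0 < e\<close>] by blast
  qed (meson order_less_le_trans)
  then obtain d1 where d1: "d1 > 0"
    "\<And>i y. i \<in> J \<Longrightarrow> y \<in> euclid_points J \<Longrightarrow> \<forall>j\<in>J. \<bar>y j - x j\<bar> < d1 \<Longrightarrow> \<bar>g' i y - g' i x\<bar> < e"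
    by blast
  obtain d2 where d2: "d2 > 0"
    "\<And>y. y \<in> euclid_points J \<Longrightarrow> \<forall>j\<in>J. \<bar>y j - x j\<bar> < d2 \<Longrightarrow> y \<in> W"
    using openin_euclid_box[OF J W] by blast
  define d where "d = min d1 d2"
  \<comment> \<open>A box rather than a ball, so that replacing coordinates one by one by those of
    another point does not leave it.\<close>
  define box where "box = {y \<in> euclid_points J. \<forall>j\<in>J. \<bar>y j - x j\<bar> < d}"
  have box: "y \<in> W" "i \<in> J \<Longrightarrow> \<bar>g' i y - g' i x\<bar> < e" if "y \<in> box" for y i
    using that d1(2)[of i y] d2(2)[of y] by (auto simp: box_def d_def)
  have upd: "y(i := t) \<in> box" if "y \<in> box" "i \<in> J" "\<bar>t - x i\<bar> < d" for y i t
    using that by (auto simp: box_def euclid_points_iff)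
  have one: "\<bar>g y - g (y(i := s)) - g' i x * (y i - s)\<bar> \<le> e * \<bar>y i - s\<bar>"
    if y: "y \<in> box" "i \<in> J" "\<bar>s - x i\<bar> < d" for y i s
  proof -
    \<comment> \<open>After subtraction of the linear term, the derivative along the segment is the
      partial derivative at the moving point minus that at x, of size at most e.\<close>
    have "norm ((g (y(i := y i)) - g' i x * y i) - (g (y(i := s)) - g' i x * s)) \<le> e * norm (y i - s)"
    proof (rule field_differentiable_bound[of "ball (x i) d"])
      fix t assume t: "t \<in> ball (x i) d"
      then have "y(i := t) \<in> box" using upd[OF y(1,2)] by (simp add: dist_real_def abs_minus_commute)
      then show "norm (g' i (y(i := t)) - g' i x) \<le> e" using box(2) y(2) by force
      have "((\<lambda>s. g ((y(i := t))(i := s))) has_real_derivative g' i (y(i := t))) (at ((y(i := t)) i))"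
        using deriv[OF y(2)] box(1) \<open>y(i := t) \<in> box\<close> by blast
      then have "((\<lambda>s. g (y(i := s))) has_real_derivative g' i (y(i := t))) (at t)" by simp
      then show "((\<lambda>t. g (y(i := t)) - g' i x * t) has_real_derivative g' i (y(i := t)) - g' i x)
          (at t within ball (x i) d)"
        using DERIV_diff[OF _ DERIV_cmult_Id] by (blast intro: has_field_derivative_at_within)
    qed (use y in \<open>auto simp: box_def dist_real_def abs_minus_commute\<close>)
    then show ?thesis by (simp add: algebra_simps)
  qed
  \<comment> \<open>The induction is over a set A outside which the two points agree; z stays fixed
    while y is moved towards it.\<close>
  have increment: "\<bar>g y - g z - (\<Sum>i\<in>A. g' i x * (y i - z i))\<bar> \<le> e * (\<Sum>i\<in>A. \<bar>y i - z i\<bar>)"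
    if "finite A" "A \<subseteq> J" "y \<in> box" "z \<in> box" "\<And>i. i \<notin> A \<Longrightarrow> y i = z i" for A y z
    using that
  proof (induction A arbitrary: y rule: finite_induct)
    case empty
    then have "y = z" by auto
    then show ?case by simp
  next
    case (insert i A)
    let ?y = "y(i := z i)"
    have zi: "\<bar>z i - x i\<bar> < d" "i \<in> J" using insert.prems by (auto simp: box_def)
    have sums: "(\<Sum>j\<in>A. g' j x * (?y j - z j)) = (\<Sum>j\<in>A. g' j x * (y j - z j))"
      "(\<Sum>j\<in>A. \<bar>?y j - z j\<bar>) = (\<Sum>j\<in>A. \<bar>y j - z j\<bar>)"
      using insert.hyps by (auto intro!: sum.cong)
    have "\<bar>g ?y - g z - (\<Sum>j\<in>A. g' j x * (?y j - z j))\<bar> \<le> e * (\<Sum>j\<in>A. \<bar>?y j - z j\<bar>)"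
      using insert.prems zi by (intro insert.IH upd) auto
    then have "\<bar>g ?y - g z - (\<Sum>j\<in>A. g' j x * (y j - z j))\<bar> \<le> e * (\<Sum>j\<in>A. \<bar>y j - z j\<bar>)"
      unfolding sums .
    moreover have "\<bar>g y - g ?y - g' i x * (y i - z i)\<bar> \<le> e * \<bar>y i - z i\<bar>"
      using one insert.prems zi by blast
    ultimately show ?case
      using insert.hyps by (simp add: distrib_left)
  qed
  have "\<bar>g y - g x - (\<Sum>i\<in>J. g' i x * (y i - x i))\<bar> \<le> e * (\<Sum>i\<in>J. \<bar>y i - x i\<bar>)"
    if y: "y \<in> W" "\<forall>i\<in>J. \<bar>y i - x i\<bar> < d" for y
  proof -
    have "y \<in> box" "x \<in> box" using y WJ W d1 d2 by (auto simp: box_def d_def)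
    moreover have "y i = x i" if "i \<notin> J" for i
      using that y(1) W(2) WJ by (metis euclid_points_iff subsetD)
    ultimately show ?thesis using increment[OF J subset_refl] by blast
  qed
  moreover have "d > 0" using d1 d2 by (simp add: d_def)
  ultimately show ?thesis by blast
qed

lemma abs_le_L2_set: "finite A \<Longrightarrow> i \<in> A \<Longrightarrow> \<bar>f i\<bar> \<le> L2_set f A"
  using member_le_L2_set[of A i "\<lambda>i. \<bar>f i\<bar>"] by (simp add: L2_set_def)

lemma L2_set_diff_triangle: "L2_set (\<lambda>i. f i - g i) A \<le> L2_set f A + L2_set g A"
  using L2_set_triangle_ineq[of f "\<lambda>i. - g i" A] by (simp add: L2_set_def)

lemma L2_set_scale: "0 \<le> c \<Longrightarrow> L2_set (\<lambda>i. c * f i) A = c * L2_set f A"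
  by (simp add: L2_set_right_distrib)

text \<open>The candidate is the Jacobian matrix; the increment estimate is used for all components
  with a common radius.\<close>

lemma has_differential_C1:
  assumes J: "finite J" "finite J'" and W: "openin (euclid J) W" "x \<in> W"
    and f: "\<And>j. j \<in> J' \<Longrightarrow> Ck_scalar J 1 W (\<lambda>y. f y j)"
  shows "\<exists>L. has_differential J J' W f x L"
proof -
  have "\<exists>g'. \<forall>i\<in>J. (\<forall>y\<in>W. ((\<lambda>t. f (y(i := t)) j) has_real_derivative g' i y) (at (y i))) \<and>
      continuous_map (subtopology (euclid J) W) euclideanreal (g' i)" if "j \<in> J'" for j
    using f[OF that] by simp
  then obtain g' where g': "\<And>j i y. j \<in> J' \<Longrightarrow> i \<in> J \<Longrightarrow> y \<in> W \<Longrightarrow>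
      ((\<lambda>t. f (y(i := t)) j) has_real_derivative g' j i y) (at (y i))"
    "\<And>j i. j \<in> J' \<Longrightarrow> i \<in> J \<Longrightarrow> continuous_map (subtopology (euclid J) W) euclideanreal (g' j i)"
    by metis
  define L where "L h j = (if j \<in> J' then \<Sum>i\<in>J. g' j i x * h i else 0)" for h :: "'a \<Rightarrow> real" and j
  have "has_differential J J' W f x L"
    unfolding has_differential_def
  proof (intro conjI ballI allI impI)
    show "L \<in> euclid_points J \<rightarrow> euclid_points J'" by (auto simp: L_def euclid_points_iff)
    show "L (\<lambda>i. h i + k i) = (\<lambda>j. L h j + L k j)" for h k
      by (auto simp: L_def fun_eq_iff distrib_left sum.distrib)
    show "L (\<lambda>i. c * h i) = (\<lambda>j. c * L h j)" for c h
      by (auto simp: L_def fun_eq_iff sum_distrib_left mult_ac)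
    fix e :: real assume "e > 0"
    \<comment> \<open>The factors come from bounding the L2 norm over J' by a sum and the sum of
      increments over J by their L2 norm; the summand 1 keeps the divisor positive in dimension
      0.\<close>
    define e' where "e' = e / (real (card J') * real (card J) + 1)"
    have "0 < real (card J') * real (card J) + 1" by (intro add_nonneg_pos) auto
    then have e': "e' > 0" "real (card J') * (e' * real (card J)) \<le> e"
      using \<open>e > 0\<close> by (auto simp: e'_def field_simps)
    have "\<exists>d>0. \<forall>j\<in>J'. \<forall>y\<in>W. (\<forall>i\<in>J. \<bar>y i - x i\<bar> < d) \<longrightarrow>
        \<bar>f y j - f x j - (\<Sum>i\<in>J. g' j i x * (y i - x i))\<bar> \<le> e' * (\<Sum>i\<in>J. \<bar>y i - x i\<bar>)"
    proof (rule finite_common_bound[OF J(2)])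
      fix j assume "j \<in> J'"
      then show "\<exists>d>0. \<forall>y\<in>W. (\<forall>i\<in>J. \<bar>y i - x i\<bar> < d) \<longrightarrow>
        \<bar>f y j - f x j - (\<Sum>i\<in>J. g' j i x * (y i - x i))\<bar> \<le> e' * (\<Sum>i\<in>J. \<bar>y i - x i\<bar>)"
        using C1_increment[OF J(1) W e'(1), of "\<lambda>y. f y j" "g' j"] g' by blast
    qed (meson order_less_le_trans)
    then obtain d where d: "d > 0" "\<And>j y. j \<in> J' \<Longrightarrow> y \<in> W \<Longrightarrow> \<forall>i\<in>J. \<bar>y i - x i\<bar> < d \<Longrightarrow>
        \<bar>f y j - f x j - (\<Sum>i\<in>J. g' j i x * (y i - x i))\<bar> \<le> e' * (\<Sum>i\<in>J. \<bar>y i - x i\<bar>)"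
      by blast
    have "L2_set (\<lambda>j. f y j - f x j - L (\<lambda>i. y i - x i) j) J' \<le> e * L2_set (\<lambda>i. y i - x i) J"
      if y: "y \<in> W" "L2_set (\<lambda>i. y i - x i) J < d" for y
    proof -
      let ?n = "L2_set (\<lambda>i. y i - x i) J"
      have le: "\<bar>y i - x i\<bar> \<le> ?n" if "i \<in> J" for i
        using abs_le_L2_set[OF J(1) that, of "\<lambda>i. y i - x i"] .
      have "(\<Sum>i\<in>J. \<bar>y i - x i\<bar>) \<le> real (card J) * ?n"
        using le by (rule sum_bounded_above)
      then have n: "e' * (\<Sum>i\<in>J. \<bar>y i - x i\<bar>) \<le> e' * (real (card J) * ?n)"
        using e' by (intro mult_left_mono) auto
      have "L2_set (\<lambda>j. f y j - f x j - L (\<lambda>i. y i - x i) j) J' \<le>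
          (\<Sum>j\<in>J'. \<bar>f y j - f x j - L (\<lambda>i. y i - x i) j\<bar>)"
        by (rule L2_set_le_sum_abs)
      also have "\<dots> \<le> real (card J') * (e' * (real (card J) * ?n))"
      proof (rule sum_bounded_above)
        fix j assume "j \<in> J'"
        have "\<forall>i\<in>J. \<bar>y i - x i\<bar> < d" using le y(2) by force
        from d(2)[OF \<open>j \<in> J'\<close> y(1) this] n
        show "\<bar>f y j - f x j - L (\<lambda>i. y i - x i) j\<bar> \<le> e' * (real (card J) * ?n)"
          using \<open>j \<in> J'\<close> by (simp add: L_def)
      qed
      also have "\<dots> = real (card J') * (e' * real (card J)) * ?n" by simp
      also have "\<dots> \<le> e * ?n" using e' by (intro mult_right_mono) auto
      finally show ?thesis .
    qed
    then show "\<exists>\<delta>>0. \<forall>y\<in>W. L2_set (\<lambda>i. y i - x i) J < \<delta> \<longrightarrow>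
        L2_set (\<lambda>j. f y j - f x j - L (\<lambda>i. y i - x i) j) J' \<le> e * L2_set (\<lambda>i. y i - x i) J"
      using d(1) by blast
  qed
  then show ?thesis by blast
qed

lemma has_differentialD:
  assumes "has_differential J J' W f x L"
  shows "\<And>h. h \<in> euclid_points J \<Longrightarrow> L h \<in> euclid_points J'"
    and "\<And>h k. h \<in> euclid_points J \<Longrightarrow> k \<in> euclid_points J \<Longrightarrow> L (\<lambda>i. h i + k i) = (\<lambda>j. L h j + L k j)"
    and "\<And>c h. h \<in> euclid_points J \<Longrightarrow> L (\<lambda>i. c * h i) = (\<lambda>j. c * L h j)"
    and "\<And>e. 0 < e \<Longrightarrow> \<exists>\<delta>>0. \<forall>y\<in>W. L2_set (\<lambda>i. y i - x i) J < \<delta> \<longrightarrow>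
        L2_set (\<lambda>j. f y j - f x j - L (\<lambda>i. y i - x i) j) J' \<le> e * L2_set (\<lambda>i. y i - x i) J"
  using assms unfolding has_differential_def by blast+

lemma has_differential_diff:
  assumes "has_differential J J' W f x L" "h \<in> euclid_points J" "k \<in> euclid_points J"
  shows "L (\<lambda>i. h i - k i) = (\<lambda>j. L h j - L k j)"
  using has_differentialD(2)[OF assms(1,2), of "\<lambda>i. (- 1) * k i"] has_differentialD(3)[OF assms(1,3), of "- 1"]
    euclid_points_linear(3)[OF assms(3,3), of "- 1"] by simp

text \<open>Expansion in unit vectors; C is the sum of the absolute values of all matrix entries.
  \<open>has_differential\<close> itself asks only for algebraic linearity, while the chain rule
  uses this bound.\<close>

lemma has_differential_bounded:
  assumes L: "has_differential J J' W f x L" and J: "finite J"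
  shows "\<exists>C\<ge>0. \<forall>h\<in>euclid_points J. L2_set (L h) J' \<le> C * L2_set h J"
proof -
  define u :: "'a \<Rightarrow> 'a \<Rightarrow> real" where "u i = (\<lambda>k. if k = i then 1 else 0)" for i
  \<comment> \<open>A contains the support of h, so deleting one coordinate of h leads to a smaller
    set.\<close>
  have expand: "L h j = (\<Sum>i\<in>A. h i * L (u i) j)"
    if "finite A" "A \<subseteq> J" "h \<in> euclid_points A" for A h j
    using that
  proof (induction A arbitrary: h rule: finite_induct)
    case empty
    then have "h = (\<lambda>i. 0)" by (auto simp: euclid_points_iff)
    then show ?case using has_differentialD(3)[OF L, of "\<lambda>i. 0" 0] by (simp add: euclid_points_iff)
  next
    case (insert a A)
    have pts: "h(a := 0) \<in> euclid_points A" "h(a := 0) \<in> euclid_points J" "u a \<in> euclid_points J"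
      using insert.prems by (auto simp: euclid_points_iff u_def)
    have "h = (\<lambda>i. (h(a := 0)) i + h a * u a i)" by (auto simp: u_def)
    then have "L h j = L (h(a := 0)) j + h a * L (u a) j"
      using has_differentialD(2)[OF L pts(2) euclid_points_linear(3)[OF pts(3,3), of "h a"]]
        has_differentialD(3)[OF L pts(3), of "h a"] by (metis (no_types, lifting))
    also have "L (h(a := 0)) j = (\<Sum>i\<in>A. (h(a := 0)) i * L (u i) j)"
      by (rule insert.IH[OF _ pts(1)]) (use insert.prems in blast)
    also have "\<dots> = (\<Sum>i\<in>A. h i * L (u i) j)"
      using insert.hyps by (intro sum.cong) auto
    finally show ?case using insert.hyps by simp
  qed
  let ?C = "\<Sum>j\<in>J'. \<Sum>i\<in>J. \<bar>L (u i) j\<bar>"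
  have "L2_set (L h) J' \<le> ?C * L2_set h J" if h: "h \<in> euclid_points J" for h
  proof -
    have "L2_set (L h) J' \<le> (\<Sum>j\<in>J'. \<bar>L h j\<bar>)" by (rule L2_set_le_sum_abs)
    also have "\<dots> \<le> (\<Sum>j\<in>J'. \<Sum>i\<in>J. \<bar>L (u i) j\<bar> * L2_set h J)"
    proof (rule sum_mono)
      fix j
      have "\<bar>L h j\<bar> \<le> (\<Sum>i\<in>J. \<bar>h i * L (u i) j\<bar>)"
        unfolding expand[OF J subset_refl h] by (rule sum_abs)
      also have "\<dots> \<le> (\<Sum>i\<in>J. \<bar>L (u i) j\<bar> * L2_set h J)"
        using abs_le_L2_set[OF J, of _ h]
        by (intro sum_mono) (simp add: abs_mult mult_right_mono mult.commute[of _ "L2_set h J"])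
      finally show "\<bar>L h j\<bar> \<le> (\<Sum>i\<in>J. \<bar>L (u i) j\<bar> * L2_set h J)" .
    qed
    also have "\<dots> = ?C * L2_set h J" by (simp add: sum_distrib_right)
    finally show ?thesis .
  qed
  moreover have "?C \<ge> 0" by (intro sum_nonneg) auto
  ultimately show ?thesis by blast
qed

text \<open>Both maps approximate the same increment at x + t h for small t. By homogeneity t
  cancels, leaving an arbitrarily small bound on L h - L' h.\<close>

lemma has_differential_unique:
  assumes J: "finite J" "finite J'" and W: "openin (euclid J) W" "x \<in> W"
    and L: "has_differential J J' W f x L" and L': "has_differential J J' W f x L'"
    and h: "h \<in> euclid_points J"
  shows "L h = L' h"
proof -
  let ?D = "L2_set (\<lambda>j. L h j - L' h j) J'" and ?n = "L2_set h J"
  have le: "?D \<le> 2 * e * ?n" if "e > 0" for e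
  proof -
    obtain d1 where d1: "d1 > 0" "\<And>y. y \<in> W \<Longrightarrow> L2_set (\<lambda>i. y i - x i) J < d1 \<Longrightarrow>
        L2_set (\<lambda>j. f y j - f x j - L (\<lambda>i. y i - x i) j) J' \<le> e * L2_set (\<lambda>i. y i - x i) J"
      using has_differentialD(4)[OF L \<open>e > 0\<close>] by blast
    obtain d2 where d2: "d2 > 0" "\<And>y. y \<in> W \<Longrightarrow> L2_set (\<lambda>i. y i - x i) J < d2 \<Longrightarrow>
        L2_set (\<lambda>j. f y j - f x j - L' (\<lambda>i. y i - x i) j) J' \<le> e * L2_set (\<lambda>i. y i - x i) J"
      using has_differentialD(4)[OF L' \<open>e > 0\<close>] by blast
    obtain d3 where d3: "d3 > 0" "\<And>y. y \<in> euclid_points J \<Longrightarrow> \<forall>i\<in>J. \<bar>y i - x i\<bar> < d3 \<Longrightarrow> y \<in> W"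
      using openin_euclid_box[OF J(1) W] by blast
    define d where "d = min d1 (min d2 d3)"
    \<comment> \<open>Chosen so that t > 0 and t * \<open>?n\<close> < d; the summand 1 covers h =
      0.\<close>
    define t where "t = d / (2 * (?n + 1))"
    have "?n \<ge> 0" by simp
    have "d > 0" using d1 d2 d3 by (simp add: d_def)
    moreover have pos: "2 * (?n + 1) > 0" by (intro mult_pos_pos add_nonneg_pos) simp_all
    ultimately have "t > 0" unfolding t_def by (rule divide_pos_pos)
    moreover have "t * (2 * (?n + 1)) = d"
      using pos unfolding t_def by (metis less_irrefl nonzero_divide_eq_eq)
    then have "d = 2 * (t * ?n) + 2 * t" by (simp add: algebra_simps)
    moreover have "0 \<le> t * ?n" using \<open>t > 0\<close> by simp
    ultimately have t: "t > 0" "t * ?n < d" by linarith+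
    define y where "y = (\<lambda>i. x i + t * h i)"
    have yx: "(\<lambda>i. y i - x i) = (\<lambda>i. t * h i)" by (simp add: y_def)
    have n: "L2_set (\<lambda>i. y i - x i) J = t * ?n"
      using t unfolding yx by (simp add: L2_set_scale)
    have "x \<in> euclid_points J" using W openin_subset by blast
    then have "y \<in> euclid_points J" using h by (simp add: y_def euclid_points_iff)
    moreover have "\<bar>y i - x i\<bar> < d3" if "i \<in> J" for i
      using abs_le_L2_set[OF J(1) that, of "\<lambda>i. y i - x i"] n t by (simp add: d_def)
    ultimately have "y \<in> W" using d3 by blast
    have "L (\<lambda>i. y i - x i) = (\<lambda>j. t * L h j)" "L' (\<lambda>i. y i - x i) = (\<lambda>j. t * L' h j)"
      unfolding yx using has_differentialD(3)[OF L h] has_differentialD(3)[OF L' h] by auto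
    then have "L2_set (\<lambda>j. f y j - f x j - t * L h j) J' \<le> e * (t * ?n)"
      "L2_set (\<lambda>j. f y j - f x j - t * L' h j) J' \<le> e * (t * ?n)"
      using d1(2)[OF \<open>y \<in> W\<close>] d2(2)[OF \<open>y \<in> W\<close>] n t by (auto simp: d_def)
    then have "L2_set (\<lambda>j. (f y j - f x j - t * L' h j) - (f y j - f x j - t * L h j)) J' \<le> 2 * e * (t * ?n)"
      using L2_set_diff_triangle[of "\<lambda>j. f y j - f x j - t * L' h j" "\<lambda>j. f y j - f x j - t * L h j" J']
      by linarith
    moreover have "(\<lambda>j. (f y j - f x j - t * L' h j) - (f y j - f x j - t * L h j)) =
        (\<lambda>j. t * (L h j - L' h j))" by (auto simp: algebra_simps)
    ultimately have "t * ?D \<le> t * (2 * e * ?n)"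
      using t by (simp add: L2_set_scale mult_ac)
    then show ?thesis using t by simp
  qed
  have "?D \<le> 0"
  proof (rule field_le_epsilon)
    fix e :: real assume "e > 0"
    have "?n \<ge> 0" by simp
    then have "2 * (e / (2 * (?n + 1))) * ?n \<le> e" "e / (2 * (?n + 1)) > 0"
      using \<open>e > 0\<close> by (auto simp: field_simps add_pos_nonneg)
    then show "?D \<le> 0 + e" using le by fastforce
  qed
  then have "?D = 0" by (simp add: order_antisym)
  then have "\<forall>j\<in>J'. L h j = L' h j" using J by (simp add: L2_set_eq_0_iff)
  moreover have "L h j = L' h j" if "j \<notin> J'" for j
    using that has_differentialD(1)[OF L h] has_differentialD(1)[OF L' h] by (simp add: euclid_points_iff)
  ultimately show ?thesis by auto
qed

text \<open>The remainder splits into that of g for the increment of f, and the image under L' of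
  the remainder of f; the bounds for L and L' control both.\<close>

lemma has_differential_compose:
  assumes J: "finite J" "finite J'" and W: "W \<subseteq> euclid_points J" "x \<in> W"
    and W': "W' \<subseteq> euclid_points J'" "f \<in> W \<rightarrow> W'"
    and L: "has_differential J J' W f x L" and L': "has_differential J' J'' W' g (f x) L'"
  shows "has_differential J J'' W (g \<circ> f) x (L' \<circ> L)"
  unfolding has_differential_def
proof (intro conjI ballI allI impI)
  show "L' \<circ> L \<in> euclid_points J \<rightarrow> euclid_points J''"
    using has_differentialD(1)[OF L] has_differentialD(1)[OF L'] by auto
  show "(L' \<circ> L) (\<lambda>i. h i + k i) = (\<lambda>j. (L' \<circ> L) h j + (L' \<circ> L) k j)"
    if "h \<in> euclid_points J" "k \<in> euclid_points J" for h k
    using that has_differentialD(1,2)[OF L] has_differentialD(2)[OF L'] by simp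
  show "(L' \<circ> L) (\<lambda>i. c * h i) = (\<lambda>j. c * (L' \<circ> L) h j)" if "h \<in> euclid_points J" for c h
    using that has_differentialD(1,3)[OF L] has_differentialD(3)[OF L'] by simp
  fix e :: real assume "e > 0"
  obtain C where C: "C \<ge> 0" "\<And>h. h \<in> euclid_points J \<Longrightarrow> L2_set (L h) J' \<le> C * L2_set h J"
    using has_differential_bounded[OF L J(1)] by blast
  obtain C' where C': "C' \<ge> 0" "\<And>h. h \<in> euclid_points J' \<Longrightarrow> L2_set (L' h) J'' \<le> C' * L2_set h J'"
    using has_differential_bounded[OF L' J(2)] by blast
  \<comment> \<open>a handles the second part: C' * a is at most e / 2. As a is also at most 1, the
    increment of f is at most C + 1 times that of the argument, so b * (C + 1) = e / 2 handles the
    first part.\<close>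
  define a where "a = min 1 (e / (2 * (C' + 1)))"
  define b where "b = e / (2 * (C + 1))"
  have a: "0 < a" "a \<le> 1" "C' * a \<le> e / 2"
  proof -
    show "0 < a" "a \<le> 1" using \<open>e > 0\<close> C'(1) by (auto simp: a_def)
    have "C' * a \<le> C' * (e / (2 * (C' + 1)))" using C'(1) by (intro mult_left_mono) (auto simp: a_def)
    also have "\<dots> \<le> e / 2" using C'(1) \<open>e > 0\<close> by (simp add: field_simps)
    finally show "C' * a \<le> e / 2" .
  qed
  have b: "0 < b" "b * (C + 1) = e / 2" using \<open>e > 0\<close> C(1) by (auto simp: b_def field_simps)
  obtain d1 where d1: "d1 > 0" "\<And>y. y \<in> W \<Longrightarrow> L2_set (\<lambda>i. y i - x i) J < d1 \<Longrightarrow>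
      L2_set (\<lambda>j. f y j - f x j - L (\<lambda>i. y i - x i) j) J' \<le> a * L2_set (\<lambda>i. y i - x i) J"
    using has_differentialD(4)[OF L a(1)] by blast
  obtain d2 where d2: "d2 > 0" "\<And>z. z \<in> W' \<Longrightarrow> L2_set (\<lambda>i. z i - f x i) J' < d2 \<Longrightarrow>
      L2_set (\<lambda>j. g z j - g (f x) j - L' (\<lambda>i. z i - f x i) j) J'' \<le> b * L2_set (\<lambda>i. z i - f x i) J'"
    using has_differentialD(4)[OF L' b(1)] by blast
  define d where "d = min d1 (d2 / (C + 1))"
  have "L2_set (\<lambda>j. (g \<circ> f) y j - (g \<circ> f) x j - (L' \<circ> L) (\<lambda>i. y i - x i) j) J'' \<le> e * L2_set (\<lambda>i. y i - x i) J"
    if y: "y \<in> W" "L2_set (\<lambda>i. y i - x i) J < d" for y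
  proof -
    let ?n = "L2_set (\<lambda>i. y i - x i) J" and ?h = "\<lambda>i. y i - x i" and ?k = "\<lambda>j. f y j - f x j"
    have h: "?h \<in> euclid_points J" using y W by (intro euclid_points_linear) auto
    have "f y \<in> W'" "f x \<in> W'" using y W W' by auto
    then have k: "?k \<in> euclid_points J'" using W' by (intro euclid_points_linear) auto
    have Lh: "L ?h \<in> euclid_points J'" using has_differentialD(1)[OF L h] .
    have r: "L2_set (\<lambda>j. ?k j - L ?h j) J' \<le> a * ?n" using d1(2) y by (auto simp: d_def)
    have "L2_set (\<lambda>j. (?k j - L ?h j) + L ?h j) J' \<le> a * ?n + C * ?n"
      using L2_set_triangle_ineq[of "\<lambda>j. ?k j - L ?h j" "L ?h" J'] r C(2)[OF h] by linarith
    also have "\<dots> \<le> (C + 1) * ?n"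
      using mult_right_mono[OF a(2), of ?n] by (simp add: algebra_simps)
    finally have kn: "L2_set ?k J' \<le> (C + 1) * ?n" by simp
    also have "\<dots> < d2" using y(2) C(1) by (simp add: d_def field_simps)
    finally have "L2_set (\<lambda>j. g (f y) j - g (f x) j - L' ?k j) J'' \<le> b * L2_set ?k J'"
      using d2(2) \<open>f y \<in> W'\<close> by blast
    also have "\<dots> \<le> b * ((C + 1) * ?n)" using kn b(1) by (intro mult_left_mono) auto
    also have "\<dots> = e / 2 * ?n" by (simp only: mult.assoc[symmetric] b(2))
    finally have 1: "L2_set (\<lambda>j. g (f y) j - g (f x) j - L' ?k j) J'' \<le> e / 2 * ?n" .
    have "L2_set (\<lambda>j. L' ?k j - L' (L ?h) j) J'' = L2_set (L' (\<lambda>j. ?k j - L ?h j)) J''"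
      using has_differential_diff[OF L' k Lh] by simp
    also have "\<dots> \<le> C' * L2_set (\<lambda>j. ?k j - L ?h j) J'"
      by (rule C'(2)[OF euclid_points_linear(2)[OF k Lh]])
    also have "\<dots> \<le> C' * (a * ?n)" using r C'(1) by (intro mult_left_mono) auto
    also have "\<dots> \<le> e / 2 * ?n" using mult_right_mono[OF a(3), of ?n] by (simp add: mult.assoc)
    finally have 2: "L2_set (\<lambda>j. L' ?k j - L' (L ?h) j) J'' \<le> e / 2 * ?n" .
    have "(\<lambda>j. g (f y) j - g (f x) j - L' (L ?h) j) =
        (\<lambda>j. (g (f y) j - g (f x) j - L' ?k j) + (L' ?k j - L' (L ?h) j))"
      by (rule ext) linarith
    then have "L2_set (\<lambda>j. g (f y) j - g (f x) j - L' (L ?h) j) J'' \<le> e / 2 * ?n + e / 2 * ?n"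
      using L2_set_triangle_ineq[of "\<lambda>j. g (f y) j - g (f x) j - L' ?k j" "\<lambda>j. L' ?k j - L' (L ?h) j" J''] 1 2
      by (simp only:)
    then show ?thesis by simp
  qed
  moreover have "d > 0" using d1 d2 C(1) by (simp add: d_def)
  ultimately show "\<exists>\<delta>>0. \<forall>y\<in>W. L2_set (\<lambda>i. y i - x i) J < \<delta> \<longrightarrow>
      L2_set (\<lambda>j. (g \<circ> f) y j - (g \<circ> f) x j - (L' \<circ> L) (\<lambda>i. y i - x i) j) J'' \<le> e * L2_set (\<lambda>i. y i - x i) J"
    by blast
qed

lemma has_differential_linear:
  assumes "f \<in> euclid_points J \<rightarrow> euclid_points J'" "x \<in> W" "W \<subseteq> euclid_points J"
    and "\<And>h k. f (\<lambda>i. h i + k i) = (\<lambda>j. f h j + f k j)" and "\<And>c h. f (\<lambda>i. c * h i) = (\<lambda>j. c * f h j)"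
  shows "has_differential J J' W f x f"
proof -
  have "f y j - f x j - f (\<lambda>i. y i - x i) j = 0" for y j
    using fun_cong[OF assms(4)[of "\<lambda>i. y i - x i" x], of j] by simp
  then have "\<exists>\<delta>>0. \<forall>y\<in>W. L2_set (\<lambda>i. y i - x i) J < \<delta> \<longrightarrow>
      L2_set (\<lambda>j. f y j - f x j - f (\<lambda>i. y i - x i) j) J' \<le> e * L2_set (\<lambda>i. y i - x i) J"
    if "e > 0" for e
    using that by (intro exI[of _ 1]) (simp add: L2_set_0')
  then show ?thesis
    using assms unfolding has_differential_def by blast
qed

text \<open>Uniqueness identifies the map picked by the choice operator with any known
  differential.\<close>

lemma differential_eqI:
  assumes "finite J" "finite J'" "openin (euclid J) W" "x \<in> W" "has_differential J J' W f x L"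
    "h \<in> euclid_points J"
  shows "differential J J' W f x h = L h"
  using has_differential_unique[OF assms(1-4) _ assms(5,6)] assms(5)
  unfolding differential_def by (metis someI)

lemma has_differential_differential:
  assumes "has_differential J J' W f x L"
  shows "has_differential J J' W f x (differential J J' W f x)"
  using assms unfolding differential_def by (metis someI)

section \<open>Closure properties of C^k functions\<close>

lemma Ck_scalar_continuous_map:
  "Ck_scalar J k W g \<Longrightarrow> continuous_map (subtopology (euclid J) W) euclideanreal g"
  by (cases k) auto

lemma Ck_scalar_SucI:
  assumes "continuous_map (subtopology (euclid J) W) euclideanreal g"
    and "\<And>i x. i \<in> J \<Longrightarrow> x \<in> W \<Longrightarrow> ((\<lambda>t. g (x(i := t))) has_real_derivative g' i x) (at (x i))"
    and "\<And>i. i \<in> J \<Longrightarrow> Ck_scalar J k W (g' i)"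
  shows "Ck_scalar J (Suc k) W g"
  using assms by auto

lemma Ck_scalar_SucE:
  assumes "Ck_scalar J (Suc k) W g"
  obtains g' where "\<And>i x. i \<in> J \<Longrightarrow> x \<in> W \<Longrightarrow> ((\<lambda>t. g (x(i := t))) has_real_derivative g' i x) (at (x i))"
    and "\<And>i. i \<in> J \<Longrightarrow> Ck_scalar J k W (g' i)"
  using assms by auto

text \<open>For the product and reciprocal rules, whose derivatives contain the undifferentiated
  functions.\<close>

lemma Ck_scalar_Suc_imp: "Ck_scalar J (Suc k) W g \<Longrightarrow> Ck_scalar J k W g"
proof (induction k arbitrary: g)
  case 0
  then show ?case by simp
next
  case (Suc k)
  obtain g' where g': "\<And>i x. i \<in> J \<Longrightarrow> x \<in> W \<Longrightarrow> ((\<lambda>t. g (x(i := t))) has_real_derivative g' i x) (at (x i))"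
    "\<And>i. i \<in> J \<Longrightarrow> Ck_scalar J (Suc k) W (g' i)"
    using Suc.prems by (rule Ck_scalar_SucE) blast
  show ?case
    by (rule Ck_scalar_SucI[OF Ck_scalar_continuous_map[OF Suc.prems] g'(1) Suc.IH[OF g'(2)]])
qed

lemma Ck_scalar_const: "Ck_scalar J k W (\<lambda>x. c)"
  by (induction k arbitrary: c) (auto intro!: exI[of _ "\<lambda>i x. 0"])

lemma continuous_map_euclid_coordinate:
  "continuous_map (subtopology (euclid J) W) euclideanreal (\<lambda>x. x a)"
  unfolding euclid_def by (intro continuous_map_from_subtopology continuous_map_product_projection) simp

lemma Ck_scalar_coordinate: "Ck_scalar J k W (\<lambda>x. x a)"
proof (cases k)
  case 0
  then show ?thesis using continuous_map_euclid_coordinate by simp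
next
  case (Suc l)
  have "((\<lambda>t. (x(i := t)) a) has_real_derivative (if i = a then 1 else 0)) (at (x i))" for i x
    by (cases "i = a") auto
  then show ?thesis unfolding Suc
    by (intro Ck_scalar_SucI[where g' = "\<lambda>i x. if i = a then 1 else 0"]
        continuous_map_euclid_coordinate Ck_scalar_const)
qed

lemma Ck_scalar_add:
  "Ck_scalar J k W g \<Longrightarrow> Ck_scalar J k W h \<Longrightarrow> Ck_scalar J k W (\<lambda>x. g x + h x)"
proof (induction k arbitrary: g h)
  case 0
  then show ?case by (simp add: continuous_map_add)
next
  case (Suc k)
  obtain g' where g': "\<And>i x. i \<in> J \<Longrightarrow> x \<in> W \<Longrightarrow> ((\<lambda>t. g (x(i := t))) has_real_derivative g' i x) (at (x i))"
    "\<And>i. i \<in> J \<Longrightarrow> Ck_scalar J k W (g' i)"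
    using Suc.prems(1) by (rule Ck_scalar_SucE) blast
  obtain h' where h': "\<And>i x. i \<in> J \<Longrightarrow> x \<in> W \<Longrightarrow> ((\<lambda>t. h (x(i := t))) has_real_derivative h' i x) (at (x i))"
    "\<And>i. i \<in> J \<Longrightarrow> Ck_scalar J k W (h' i)"
    using Suc.prems(2) by (rule Ck_scalar_SucE) blast
  show ?case
  proof (rule Ck_scalar_SucI[where g' = "\<lambda>i x. g' i x + h' i x"])
    show "continuous_map (subtopology (euclid J) W) euclideanreal (\<lambda>x. g x + h x)"
      using Suc.prems by (intro continuous_map_add Ck_scalar_continuous_map)
  qed (intro DERIV_add Suc.IH g' h'; assumption)+
qed

lemma Ck_scalar_mult:
  "Ck_scalar J k W g \<Longrightarrow> Ck_scalar J k W h \<Longrightarrow> Ck_scalar J k W (\<lambda>x. g x * h x)"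
proof (induction k arbitrary: g h)
  case 0
  then show ?case by (simp add: continuous_map_real_mult)
next
  case (Suc k)
  obtain g' where g': "\<And>i x. i \<in> J \<Longrightarrow> x \<in> W \<Longrightarrow> ((\<lambda>t. g (x(i := t))) has_real_derivative g' i x) (at (x i))"
    "\<And>i. i \<in> J \<Longrightarrow> Ck_scalar J k W (g' i)"
    using Suc.prems(1) by (rule Ck_scalar_SucE) blast
  obtain h' where h': "\<And>i x. i \<in> J \<Longrightarrow> x \<in> W \<Longrightarrow> ((\<lambda>t. h (x(i := t))) has_real_derivative h' i x) (at (x i))"
    "\<And>i. i \<in> J \<Longrightarrow> Ck_scalar J k W (h' i)"
    using Suc.prems(2) by (rule Ck_scalar_SucE) blast
  show ?case
  proof (rule Ck_scalar_SucI[where g' = "\<lambda>i x. g' i x * h x + h' i x * g x"])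
    show "continuous_map (subtopology (euclid J) W) euclideanreal (\<lambda>x. g x * h x)"
      using Suc.prems by (intro continuous_map_real_mult Ck_scalar_continuous_map)
    show "((\<lambda>t. g (x(i := t)) * h (x(i := t))) has_real_derivative g' i x * h x + h' i x * g x) (at (x i))"
      if "i \<in> J" "x \<in> W" for i x
      using DERIV_mult[OF g'(1)[OF that] h'(1)[OF that]] by simp
    show "Ck_scalar J k W (\<lambda>x. g' i x * h x + h' i x * g x)" if "i \<in> J" for i
      by (intro Ck_scalar_add Suc.IH g'(2)[OF that] h'(2)[OF that] Suc.prems[THEN Ck_scalar_Suc_imp])
  qed
qed

lemma Ck_scalar_diff:
  assumes "Ck_scalar J k W g" "Ck_scalar J k W h"
  shows "Ck_scalar J k W (\<lambda>x. g x - h x)"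
  using Ck_scalar_add[OF assms(1) Ck_scalar_mult[OF Ck_scalar_const[of J k W "- 1"] assms(2)]] by simp

lemma Ck_scalar_inverse:
  assumes "\<And>x. x \<in> W \<Longrightarrow> g x \<noteq> 0"
  shows "Ck_scalar J k W g \<Longrightarrow> Ck_scalar J k W (\<lambda>x. inverse (g x))"
proof (induction k)
  case 0
  then show ?case using assms by (auto intro: continuous_map_real_inverse)
next
  case (Suc k)
  obtain g' where g': "\<And>i x. i \<in> J \<Longrightarrow> x \<in> W \<Longrightarrow> ((\<lambda>t. g (x(i := t))) has_real_derivative g' i x) (at (x i))"
    "\<And>i. i \<in> J \<Longrightarrow> Ck_scalar J k W (g' i)"
    using Suc.prems(1) by (rule Ck_scalar_SucE) blast
  \<comment> \<open>The derivative of 1 / g is written as a product containing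
    \<open>inverse (g x)\<close> twice, so that the induction hypothesis for 1 / g applies to
    it.\<close>
  show ?case
  proof (rule Ck_scalar_SucI[where g' = "\<lambda>i x. - 1 * (inverse (g x) * g' i x * inverse (g x))"])
    show "continuous_map (subtopology (euclid J) W) euclideanreal (\<lambda>x. inverse (g x))"
      using Ck_scalar_continuous_map[OF Suc.prems] assms by (auto intro: continuous_map_real_inverse)
    show "((\<lambda>t. inverse (g (x(i := t)))) has_real_derivative - 1 * (inverse (g x) * g' i x * inverse (g x))) (at (x i))"
      if "i \<in> J" "x \<in> W" for i x
      using DERIV_inverse'[OF g'(1)[OF that]] assms[OF that(2)] by simp
    show "Ck_scalar J k W (\<lambda>x. - 1 * (inverse (g x) * g' i x * inverse (g x)))" if "i \<in> J" for i
      by (intro Ck_scalar_mult Suc.IH g'(2)[OF that] Ck_scalar_const Suc.prems[THEN Ck_scalar_Suc_imp])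
  qed
qed

text \<open>A partial derivative at x also sees the values at x(i := t); openness of W puts these
  points into W for t close to x i.\<close>

lemma Ck_scalar_cong:
  assumes J: "finite J" and W: "openin (euclid J) W" and eq: "\<And>x. x \<in> W \<Longrightarrow> g x = h x"
    and g: "Ck_scalar J k W g"
  shows "Ck_scalar J k W h"
proof -
  have cont: "continuous_map (subtopology (euclid J) W) euclideanreal h"
    using Ck_scalar_continuous_map[OF g] by (rule continuous_map_eq) (simp add: eq)
  show ?thesis
  proof (cases k)
    case 0
    then show ?thesis using cont by simp
  next
    case (Suc l)
    obtain g' where g': "\<And>i x. i \<in> J \<Longrightarrow> x \<in> W \<Longrightarrow> ((\<lambda>t. g (x(i := t))) has_real_derivative g' i x) (at (x i))"
      "\<And>i. i \<in> J \<Longrightarrow> Ck_scalar J l W (g' i)"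
      using g unfolding Suc by (rule Ck_scalar_SucE) blast
    have "((\<lambda>t. h (x(i := t))) has_real_derivative g' i x) (at (x i))" if i: "i \<in> J" "x \<in> W" for i x
    proof -
      have "x \<in> euclid_points J" using W i(2) openin_subset by blast
      obtain d where d: "d > 0" "\<And>y. y \<in> euclid_points J \<Longrightarrow> \<forall>i\<in>J. \<bar>y i - x i\<bar> < d \<Longrightarrow> y \<in> W"
        using openin_euclid_box[OF J W i(2)] by blast
      have "x(i := t) \<in> W" if "t \<in> ball (x i) d" for t
        using d that i \<open>x \<in> euclid_points J\<close>
        by (intro d(2)) (auto simp: euclid_points_iff dist_real_def abs_minus_commute)
      then show ?thesis
        using d(1) eq
        by (intro has_field_derivative_transform_within_open[OF g'(1)[OF i] open_ball[of "x i" d]]) simp_all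
    qed
    then show ?thesis unfolding Suc using cont g'(2) by (intro Ck_scalar_SucI)
  qed
qed

text \<open>A crossing time is a rational expression in two coordinates with nonvanishing
  denominator.\<close>

lemma Ck_scalar_cross_time:
  assumes "finite J" "openin (euclid J) W"
    and g: "g \<in> W \<rightarrow> euclid_points A" "\<And>a. a \<in> A \<Longrightarrow> Ck_scalar J m W (\<lambda>x. g x a)"
    and ne: "\<And>x. x \<in> W \<Longrightarrow> g x (\<sigma>, k + 1) \<noteq> g x (\<sigma>, k)"
  shows "Ck_scalar J m W (\<lambda>x. cross_time \<epsilon> k \<sigma> (g x))"
proof -
  \<comment> \<open>Coordinates outside A are constantly 0. For A = K \<times> {1..N} this covers
    the boundary indices 0 and N + 1, which occur in the first and last pieces.\<close>
  have "Ck_scalar J m W (\<lambda>x. g x a)" for a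
  proof (cases "a \<in> A")
    case False
    then have "g x a = 0" if "x \<in> W" for x
      using Pi_mem[OF g(1) that] unfolding euclid_points_iff by blast
    then show ?thesis
      using Ck_scalar_const[of J m W 0] by (auto intro: Ck_scalar_cong[OF assms(1,2)])
  qed (use g in auto)
  then show ?thesis
    using ne unfolding cross_time_def divide_inverse
    by (intro Ck_scalar_add Ck_scalar_mult Ck_scalar_inverse Ck_scalar_diff Ck_scalar_const) auto
qed

section \<open>The local lift\<close>

lemma nth_beyond: "length xs \<le> n \<Longrightarrow> xs ! n = [] ! (n - length xs)"
proof (induction xs arbitrary: n)
  case (Cons x xs)
  then show ?case by (cases n) auto
qed simp

text \<open>The arrows beyond the length of a zigzag are values of \<^const>\<open>nth\<close> out of range, which
  depend on the length of the list only.\<close>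

lemma homology_zigzag_cong:
  assumes "map snd f = map snd g"
  shows "homology_zigzag p f = homology_zigzag p g"
proof -
  have len: "length f = length g" using assms map_eq_imp_length_eq by blast
  have "snd (f ! i) = snd (g ! i)" for i
  proof (cases "i < length f")
    case True
    then show ?thesis using assms len by (metis nth_map)
  next
    case False
    then show ?thesis using len nth_beyond[of f i] nth_beyond[of g i] by simp
  qed
  then have "ev f = ev g" by (simp add: ev_def fun_eq_iff)
  moreover have "complex_after f = complex_after g" by (simp add: complex_after_def assms fun_eq_iff)
  ultimately show ?thesis by (simp only: homology_zigzag_def len)
qed

text \<open>The given I is arbitrary, and the list from \<open>S_cell\<close> carries its own
  indices. Kind and time of an event at v determine its piece, so the two agree, and the formula for
  the times holds at w.\<close>

lemma S_cell_lift:
  assumes "finite K" "0 < \<epsilon>" "event_order K R" and v: "v \<in> FF N K" and w: "w \<in> cell N K \<epsilon> v"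
    and I: "indexing_function N \<epsilon> v (S N K \<epsilon> R v) I"
  shows "map snd (S N K \<epsilon> R w) = map snd (S N K \<epsilon> R v)"
    and "ev_time (S N K \<epsilon> R w) = S_lift \<epsilon> (S N K \<epsilon> R v) I w"
proof -
  obtain cs where cs: "set cs = event_crossings N K \<epsilon> v"
    "\<And>w. w \<in> cell N K \<epsilon> v \<Longrightarrow> S N K \<epsilon> R w = map (\<lambda>x. (event_time \<epsilon> w x, fst x)) cs"
    using S_cell[OF assms(1-4)] by blast
  have "v \<in> cell N K \<epsilon> v" using v by (simp add: cell_def)
  note Sv = cs(2)[OF this] and Sw = cs(2)[OF w]
  show "map snd (S N K \<epsilon> R w) = map snd (S N K \<epsilon> R v)" by (simp add: Sv Sw)
  show "ev_time (S N K \<epsilon> R w) = S_lift \<epsilon> (S N K \<epsilon> R v) I w"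
  proof
    fix i
    show "ev_time (S N K \<epsilon> R w) i = S_lift \<epsilon> (S N K \<epsilon> R v) I w i"
    proof (cases "i \<in> {1..length cs}")
      case True
      define x where "x = cs ! (i - 1)"
      have "i - 1 < length cs" using True by auto
      then have x: "x \<in> event_crossings N K \<epsilon> v" "ev (S N K \<epsilon> R v) i = fst x"
        "ev_time (S N K \<epsilon> R v) i = event_time \<epsilon> v x" "ev_time (S N K \<epsilon> R w) i = event_time \<epsilon> w x"
        unfolding x_def cs(1)[symmetric] using True by (simp_all add: Sv Sw ev_def ev_time_def)
      have "i \<in> {1..length (S N K \<epsilon> R v)}" using True by (simp add: Sv)
      note Ii = I[unfolded indexing_function_def, THEN bspec, OF this, unfolded x(2,3)]
      have "I i = snd x"
      proof (rule event_index_unique[of "fst x" \<epsilon> v])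
        show "if is_insertion (fst x) then entry \<epsilon> v (esimplex (fst x)) (I i)
            else exit \<epsilon> v (esimplex (fst x)) (I i)"
          "cross_time \<epsilon> (I i) (esimplex (fst x)) v = event_time \<epsilon> v x"
          using Ii by simp_all
      qed (rule event_crossings_entry_exit[OF x(1)])
      then show ?thesis using True x by (simp add: S_lift_def Sv)
    qed (auto simp: S_lift_def ev_time_def Sv Sw)
  qed
qed

section \<open>Regularity of the event times\<close>

text \<open>Crossings persist along a cell, and a crossing separates the two end values by
  \<open>\<epsilon>\<close>, so they stay different.\<close>

lemma cell_subset_S_domain:
  assumes "v \<in> FF N K" "indexing_function N \<epsilon> v f I"
  shows "cell N K \<epsilon> v \<subseteq> S_domain N K f I"
proof
  fix w assume w: "w \<in> cell N K \<epsilon> v"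
  have "w (esimplex (ev f i), I i + 1) \<noteq> w (esimplex (ev f i), I i)" if "i \<in> {1..length f}" for i
  proof -
    have "I i \<le> N" and "entry \<epsilon> v (esimplex (ev f i)) (I i) \<or> exit \<epsilon> v (esimplex (ev f i)) (I i)"
      using assms(2) that by (auto simp: indexing_function_def split: if_splits)
    then have "entry \<epsilon> w (esimplex (ev f i)) (I i) \<or> exit \<epsilon> w (esimplex (ev f i)) (I i)"
      using cell_entry_exit[OF assms(1) w] by blast
    then show ?thesis by (auto simp: entry_def exit_def)
  qed
  then show "w \<in> S_domain N K f I" using w by (simp add: S_domain_def cell_def FF_def)
qed

lemma openin_S_domain: "openin (euclid (K \<times> {1..N})) (S_domain N K f I)"
proof -
  let ?X = "euclid (K \<times> {1..N})"
  let ?P = "\<lambda>w i. w (esimplex (ev f i), I i + 1) - w (esimplex (ev f i), I i)"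
  have "openin ?X {w \<in> topspace ?X. ?P w i \<in> - {0}}" for i
  proof (rule openin_continuous_map_preimage)
    show "continuous_map ?X euclideanreal (\<lambda>w. ?P w i)"
      using continuous_map_euclid_coordinate[of "K \<times> {1..N}" UNIV]
      by (intro continuous_map_diff) simp_all
  qed (auto intro: open_Compl)
  \<comment> \<open>Intersecting with the whole space accounts for an empty event list, where the
    indexed intersection is \<open>UNIV\<close>.\<close>
  then have "openin ?X ((\<Inter>i\<in>{1..length f}. {w \<in> topspace ?X. ?P w i \<in> - {0}}) \<inter> topspace ?X)"
    by (intro openin_INT) auto
  also have "(\<Inter>i\<in>{1..length f}. {w \<in> topspace ?X. ?P w i \<in> - {0}}) \<inter> topspace ?X = S_domain N K f I"
    by (auto simp: S_domain_def)
  finally show ?thesis .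
qed

lemma Ck_scalar_S_lift:
  assumes "finite J" "openin (euclid J) W" and g: "g \<in> W \<rightarrow> S_domain N K f I"
    and "\<And>a. a \<in> K \<times> {1..N} \<Longrightarrow> Ck_scalar J m W (\<lambda>x. g x a)"
  shows "Ck_scalar J m W (\<lambda>x. S_lift \<epsilon> f I (g x) i)"
proof (cases "i \<in> {1..length f}")
  case True
  then have "Ck_scalar J m W (\<lambda>x. cross_time \<epsilon> (I i) (esimplex (ev f i)) (g x))"
    using g assms(4) by (intro Ck_scalar_cross_time[OF assms(1,2), of _ "K \<times> {1..N}"])
      (auto simp: S_domain_def Pi_iff)
  then show ?thesis using True by (simp add: S_lift_def)
next
  case False
  then have "S_lift \<epsilon> f I w i = 0" for w by (auto simp: S_lift_def)
  then show ?thesis using Ck_scalar_const by simp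
qed

lemma S_lift_euclid_points: "S_lift \<epsilon> f I w \<in> euclid_points {1..length f}"
  by (simp add: euclid_points_iff S_lift_def)

text \<open>The identity as inner map turns the regularity of compositions with
  \<open>S_lift\<close> into that of \<open>S_lift\<close> itself.\<close>

lemma has_differential_S_lift:
  assumes "finite K" "w \<in> S_domain N K f I"
  shows "\<exists>L. has_differential (K \<times> {1..N}) {1..length f} (S_domain N K f I) (S_lift \<epsilon> f I) w L"
  using assms openin_S_domain
  by (intro has_differential_C1 Ck_scalar_S_lift[of _ _ "\<lambda>x. x"]) (auto simp: Ck_scalar_coordinate)

section \<open>Coordinate selection and diagrams\<close>

lemma nth_concat_pairs:
  assumes "k < length ps"
  shows "concat (map (\<lambda>(i, j). [i, j]) ps) ! (2 * k) = fst (ps ! k)"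
    "concat (map (\<lambda>(i, j). [i, j]) ps) ! (2 * k + 1) = snd (ps ! k)"
proof -
  have "concat (map (\<lambda>(i, j). [i, j]) ps) ! (2 * k) = fst (ps ! k) \<and>
      concat (map (\<lambda>(i, j). [i, j]) ps) ! (2 * k + 1) = snd (ps ! k)"
    using assms
  proof (induction ps arbitrary: k)
    case (Cons p ps)
    then show ?case by (cases k; cases p) auto
  qed simp
  then show "concat (map (\<lambda>(i, j). [i, j]) ps) ! (2 * k) = fst (ps ! k)"
    "concat (map (\<lambda>(i, j). [i, j]) ps) ! (2 * k + 1) = snd (ps ! k)" by auto
qed

lemma length_concat_pairs: "length (concat (map (\<lambda>(i, j). [i, j]) ps)) = 2 * length ps"
  by (induction ps) auto

lemma PH_lift_nth:
  assumes "k < length ps"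
  shows "PH_lift ps t (2 * k + 1) = t (fst (ps ! k))" "PH_lift ps t (2 * k + 2) = t (snd (ps ! k))"
  using assms nth_concat_pairs[OF assms] by (auto simp: PH_lift_def length_concat_pairs)

text \<open>Both members of a pair index times, so all points have finite death time and the second
  block of \<open>Q\<close> is empty. The interleaved coordinates 2i - 1 and 2i are where
  \<open>PH_lift\<close> writes the i-th pair.\<close>

lemma Q_PH_lift:
  "Q (length ps) 0 (PH_lift ps t) = image_mset (\<lambda>(i, j). (t i, ereal (t j))) (mset ps)"
proof -
  have "map (\<lambda>i. (PH_lift ps t (2 * i - 1), ereal (PH_lift ps t (2 * i)))) [1..<length ps + 1] =
      map (\<lambda>(i, j). (t i, ereal (t j))) ps"
    by (rule nth_equalityI) (use PH_lift_nth[of _ ps t] in \<open>auto simp: split_beta simp del: upt_Suc\<close>)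
  then show ?thesis by (simp add: Q_def)
qed

text \<open>Copying coordinates is additive and homogeneous, so the remainder vanishes
  identically.\<close>

lemma has_differential_PH_lift:
  assumes "x \<in> euclid_points J"
  shows "has_differential J {1..2 * length ps} (euclid_points J) (PH_lift ps) x (PH_lift ps)"
  by (rule has_differential_linear)
    (use assms in \<open>auto simp: PH_lift_def euclid_points_iff length_concat_pairs fun_eq_iff Let_def\<close>)

lemma Ck_scalar_PH_lift:
  assumes "\<And>i. Ck_scalar J m W (\<lambda>x. g x i)"
  shows "Ck_scalar J m W (\<lambda>x. PH_lift ps (g x) k)"
proof (cases "k \<in> {1..2 * length ps}")
  case True
  then show ?thesis using assms by (simp add: PH_lift_def length_concat_pairs Let_def)
next
  case False
  then have "PH_lift ps t k = 0" for t by (auto simp: PH_lift_def length_concat_pairs Let_def)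
  then show ?thesis using Ck_scalar_const by simp
qed

section \<open>Charts and the assembled lift\<close>

lemma inv_into_chart:
  assumes "smooth_manifold M" "(D, \<phi>) \<in> atlas M" "y \<in> D"
  shows "inv_into D \<phi> (\<phi> y) = y"
proof -
  have "openin (mtop M) D"
    "homeomorphic_map (subtopology (mtop M) D) (subtopology (euclid (coords M)) (\<phi> ` D)) \<phi>"
    using assms(1,2) by (auto simp: smooth_manifold_def)
  then have "inj_on \<phi> D"
    using homeomorphic_imp_injective_map openin_subset by (metis topspace_subtopology_subset)
  then show ?thesis using assms(3) by simp
qed

theorem corollary3p7:
  fixes K :: "'v set set" and N p :: nat and \<epsilon> :: real and r :: enat
    and F :: "'f::field itself" and R :: "'v event rel"
    and M :: "'m manifold" and G :: "'m \<Rightarrow> ('v set \<times> nat \<Rightarrow> real)" and \<theta> :: 'm and U :: "'m set"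
    and I :: "nat \<Rightarrow> nat" and ps :: "(nat \<times> nat) list"
  defines "\<P> \<equiv> \<lambda>x. PH F p (S N K \<epsilon> R (G x))"
    and "f \<equiv> S N K \<epsilon> R (G \<theta>)"
    and "Bt \<equiv> \<lambda>x. PH_lift ps (S_lift \<epsilon> (S N K \<epsilon> R (G \<theta>)) I (G x))"
  assumes "finite_simplicial_complex K" and "\<epsilon> > 0" and "event_order K R"
    and "smooth_manifold M" and "G \<in> topspace (mtop M) \<rightarrow> FF N K" and "\<theta> \<in> topspace (mtop M)"
    and "indexing_function N \<epsilon> (G \<theta>) f I"
    and "mset ps = persistence_pairs F p f"
    and "openin (mtop M) U" and "\<theta> \<in> U"
    and "\<forall>\<theta>'\<in>U. G \<theta>' \<in> cell N K \<epsilon> (G \<theta>)"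
    and "Cr_map r M (K \<times> {1..N}) U G"
  shows "local_lift r M \<P> \<theta> U (size (persistence_pairs F p f)) 0 Bt \<and>
    r_differentiable r M \<P> \<theta> \<and>
    (1 \<le> r \<longrightarrow>
      (\<forall>\<xi>\<in>tangent_space M \<theta>.
        lift_differential M U (size (persistence_pairs F p f)) 0 Bt \<theta> \<xi> =
        differential {1..length f} {1..2 * size (persistence_pairs F p f)}
          (euclid_points {1..length f}) (PH_lift ps) (S_lift \<epsilon> f I (G \<theta>))
          (differential (K \<times> {1..N}) {1..length f} (S_domain N K f I) (S_lift \<epsilon> f I) (G \<theta>)
            (mdifferential M (K \<times> {1..N}) U G \<theta> \<xi>))))"
proof -
  have K: "finite K" "finite (K \<times> {1..N})"
    using assms(4) by (auto simp: finite_simplicial_complex_def)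
  have v: "G \<theta> \<in> FF N K" using assms by auto
  have I: "indexing_function N \<epsilon> (G \<theta>) (S N K \<epsilon> R (G \<theta>)) I" using assms by simp
  have m: "size (persistence_pairs F p f) = length ps" using assms(11) by (metis size_mset)
  have dom: "G x \<in> S_domain N K f I" if "x \<in> U" for x
    using that assms(14) cell_subset_S_domain[OF v I] unfolding f_def by blast

  have lift: "\<P> x = Q (length ps) 0 (Bt x)" if "x \<in> U" for x
  proof -
    have w: "G x \<in> cell N K \<epsilon> (G \<theta>)" using that assms by blast
    note * = S_cell_lift[OF K(1) assms(5,6) v w I]
    \<comment> \<open>The zigzags at x and at \<theta> are equal, not merely isomorphic, so
      \<open>barcode\<close> returns the same multiset and ps enumerates the pairs throughout
      U.\<close>
    have "persistence_pairs F p (S N K \<epsilon> R (G x)) = mset ps"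
      unfolding assms(11) f_def persistence_pairs_def homology_zigzag_cong[OF *(1)] ..
    then show ?thesis by (simp add: \<P>_def Bt_def PH_def *(2) Q_PH_lift)
  qed

  have chart: "openin (euclid (coords M)) (\<phi> ` (D \<inter> U))"
    "in_chart (D, \<phi>) G \<in> \<phi> ` (D \<inter> U) \<rightarrow> S_domain N K f I"
    "\<And>a k. a \<in> K \<times> {1..N} \<Longrightarrow> enat k \<le> r \<Longrightarrow>
      Ck_scalar (coords M) k (\<phi> ` (D \<inter> U)) (\<lambda>x. in_chart (D, \<phi>) G x a)"
    if c: "(D, \<phi>) \<in> atlas M" for D \<phi>
  proof -
    have "Cr_on r (coords M) (K \<times> {1..N}) (\<phi> ` (D \<inter> U)) (in_chart (D, \<phi>) G)"
      using assms(15) c by (auto simp: Cr_map_def)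
    then show "openin (euclid (coords M)) (\<phi> ` (D \<inter> U))" and
      "\<And>a k. a \<in> K \<times> {1..N} \<Longrightarrow> enat k \<le> r \<Longrightarrow>
        Ck_scalar (coords M) k (\<phi> ` (D \<inter> U)) (\<lambda>x. in_chart (D, \<phi>) G x a)"
      unfolding Cr_on_def by blast+
    show "in_chart (D, \<phi>) G \<in> \<phi> ` (D \<inter> U) \<rightarrow> S_domain N K f I"
      using inv_into_chart[OF assms(7) c] dom by (auto simp: in_chart_def)
  qed
  \<comment> \<open>Passing to a chart is composition on the right and leaves the outer maps
    untouched.\<close>
  have Bt_chart: "in_chart c Bt = PH_lift ps \<circ> (S_lift \<epsilon> f I \<circ> in_chart c G)" for c
    by (simp add: in_chart_def Bt_def f_def fun_eq_iff)

  have "Cr_on r (coords M) {1..2 * length ps} (\<phi> ` (D \<inter> U)) (in_chart (D, \<phi>) Bt)"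
    if c: "(D, \<phi>) \<in> atlas M" for D \<phi>
    unfolding Cr_on_def Bt_chart comp_def
  proof (intro conjI ballI allI impI)
    fix j k assume "enat k \<le> r"
    then show "Ck_scalar (coords M) k (\<phi> ` (D \<inter> U)) (\<lambda>x. PH_lift ps (S_lift \<epsilon> f I (in_chart (D, \<phi>) G x)) j)"
      by (intro Ck_scalar_PH_lift Ck_scalar_S_lift[OF _ chart(1,2)[OF c]] chart(3)[OF c]) auto
  qed (use chart(1)[OF c] in \<open>auto simp: PH_lift_def length_concat_pairs Let_def euclid_points_iff\<close>)
  then have "Cr_map r M {1..2 * length ps} U Bt" by (auto simp: Cr_map_def)
  then have local_lift: "local_lift r M \<P> \<theta> U (length ps) 0 Bt"
    using assms(12,13) lift by (simp add: local_lift_def)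

  have "lift_differential M U (length ps) 0 Bt \<theta> \<xi> =
      differential {1..length f} {1..2 * length ps} (euclid_points {1..length f}) (PH_lift ps)
        (S_lift \<epsilon> f I (G \<theta>))
        (differential (K \<times> {1..N}) {1..length f} (S_domain N K f I) (S_lift \<epsilon> f I) (G \<theta>)
          (mdifferential M (K \<times> {1..N}) U G \<theta> \<xi>))"
    if r: "1 \<le> r" and \<xi>: "\<xi> \<in> tangent_space M \<theta>" for \<xi>
  proof -
    \<comment> \<open>Both occurrences of \<open>mdifferential\<close> use this same choice of
      chart, so both sides are evaluated at the one coordinate vector \<xi> c.\<close>
    define c where "c = (SOME c. c \<in> charts_at M \<theta>)"
    obtain D \<phi> where c_eq: "c = (D, \<phi>)" by (cases c)
    have "\<theta> \<in> (\<Union>c\<in>atlas M. fst c)" using assms(7,9) unfolding smooth_manifold_def by blast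
    then have "\<exists>c. c \<in> charts_at M \<theta>" by (auto simp: charts_at_def)
    then have c_at: "c \<in> charts_at M \<theta>" unfolding c_def by (rule someI_ex)
    then have c: "(D, \<phi>) \<in> atlas M" "\<theta> \<in> D" by (auto simp: charts_at_def c_eq)
    have h: "\<xi> c \<in> euclid_points (coords M)"
      using \<xi> c_at unfolding tangent_space_def by blast
    define W where "W = \<phi> ` (D \<inter> U)"
    define g where "g = in_chart c G"
    have W: "openin (euclid (coords M)) W" "\<phi> \<theta> \<in> W" "W \<subseteq> euclid_points (coords M)"
      using chart(1)[OF c(1)] c assms(13) openin_subset by (auto simp: W_def)
    have g: "g (\<phi> \<theta>) = G \<theta>" "g \<in> W \<rightarrow> S_domain N K f I"
      using inv_into_chart[OF assms(7) c] chart(2)[OF c(1)] by (auto simp: g_def in_chart_def c_eq W_def)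
    have Lg: "has_differential (coords M) (K \<times> {1..N}) W g (\<phi> \<theta>)
        (differential (coords M) (K \<times> {1..N}) W g (\<phi> \<theta>))" (is "has_differential _ _ _ _ _ ?Lg")
    proof -
      have "\<exists>L. has_differential (coords M) (K \<times> {1..N}) W g (\<phi> \<theta>) L"
        by (rule has_differential_C1)
          (use chart(3)[OF c(1), of _ 1] r K W in \<open>auto simp: g_def W_def c_eq one_enat_def\<close>)
      then show ?thesis using has_differential_differential by blast
    qed
    have LS: "has_differential (K \<times> {1..N}) {1..length f} (S_domain N K f I) (S_lift \<epsilon> f I) (g (\<phi> \<theta>))
        (differential (K \<times> {1..N}) {1..length f} (S_domain N K f I) (S_lift \<epsilon> f I) (G \<theta>))"
      (is "has_differential _ _ _ _ _ ?LS")
      using has_differential_S_lift[OF K(1) dom[OF assms(13)], of \<epsilon>] has_differential_differential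
      unfolding g(1) by blast
    have LP: "has_differential {1..length f} {1..2 * length ps} (euclid_points {1..length f}) (PH_lift ps)
        (S_lift \<epsilon> f I (G \<theta>))
        (differential {1..length f} {1..2 * length ps} (euclid_points {1..length f}) (PH_lift ps)
          (S_lift \<epsilon> f I (G \<theta>)))"
      (is "has_differential _ _ _ _ _ ?LP")
      using has_differential_PH_lift[OF S_lift_euclid_points] by (rule has_differential_differential)
    \<comment> \<open>Two applications of the chain rule, through the open set
      \<open>S_domain\<close> and then through the full space of event times; uniqueness of the
      differential turns the composite into the formula.\<close>
    have "has_differential (coords M) {1..length f} W (S_lift \<epsilon> f I \<circ> g) (\<phi> \<theta>) (?LS \<circ> ?Lg)"
      using K W g LS Lg openin_subset[OF openin_S_domain[of K N f I]]
      by (intro has_differential_compose[of _ "K \<times> {1..N}" _ _ "S_domain N K f I"]) auto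
    then have comp: "has_differential (coords M) {1..2 * length ps} W (PH_lift ps \<circ> (S_lift \<epsilon> f I \<circ> g)) (\<phi> \<theta>)
        (?LP \<circ> (?LS \<circ> ?Lg))"
      using W g(1) LP S_lift_euclid_points
      by (intro has_differential_compose[of _ "{1..length f}" _ _ "euclid_points {1..length f}"]) auto
    have "differential (coords M) {1..2 * length ps} W (PH_lift ps \<circ> (S_lift \<epsilon> f I \<circ> g)) (\<phi> \<theta>) (\<xi> c) =
        (?LP \<circ> (?LS \<circ> ?Lg)) (\<xi> c)"
      by (rule differential_eqI[OF finite_atLeastAtMost finite_atLeastAtMost W(1,2) comp h])
    then show ?thesis
      unfolding lift_differential_def mdifferential_def Let_def c_def[symmetric]
      by (simp add: c_eq W_def g_def Bt_chart)
  qed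
  with local_lift show ?thesis
    unfolding m r_differentiable_def by blast
qed

end
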